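(* Let $\alpha=2$ and let $M_\beta$ be an even positive function on $\mathbb{R}^d$ with $\langle M_\beta\rangle=1$, $\langle vM_\beta\rangle=0$ and $\langle v\otimes v\,M_\beta(v)\rangle<+\infty$ (diffusion scaling). Consider the scheme defined for all $k$ and all time indices $0\le n\le N$, $N\Delta t=T$, by \[ \hat\rho^{n+1}(k)=\left\langle \frac{\hat f^n}{1+\mathrm{i}\lambda\varepsilon k\cdot v} \right\rangle \left(\left\langle \frac{M_\beta}{1+\mathrm{i}\lambda\varepsilon k\cdot v} \right\rangle +\frac{1}{1-\lambda}\left\langle \frac{\mathrm{i} \lambda\varepsilon k\cdot v\, M_\beta}{1+\mathrm{i} \lambda\varepsilon k\cdot v} \right\rangle\right)^{-1}, \] \[ \hat f^{n+1}=\frac{1}{1+\mathrm{i}\lambda\varepsilon k\cdot v} \left[ (1-\lambda) \hat f^n+\lambda \hat\rho^{n+1}M_\beta\right], \] with $\lambda=\Delta t/(\varepsilon^2+\Delta t)$ and with the initial condition $\hat f^0(k,v)=\hat f_0(k,v)$. This scheme has the following properties: (i) The scheme is of order $1$ (in time, as an approximation of the kinetic equation $\varepsilon^2\partial_t f+\varepsilon v\cdot\nabla_x f=\rho M_\beta-f$) for any fixed $\varepsilon$, and it preserves the total mass: for all $n\in\{1,\dots,N\}$, $\hat\rho^n(0)=\hat\rho^0(0)$. (ii) The scheme is AP (Asymptotic Preserving): for a fixed $\Delta t$, when $\varepsilon$ goes to zero the scheme solves the diffusion equation, i.e. it degenerates into \[ \frac{\hat\rho^{n+1}(k)-\hat\rho^n(k)}{\Delta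 t}=-\left\langle (k\cdot v)^2 M_\beta(v)\right\rangle\hat\rho^{n+1}(k). \]
   Context: Brackets denote integration over velocity: $\langle h\rangle=\int_{\mathbb{R}^d}h(v)\,\mathrm{d}v$, $d\in\{1,2,3\}$. The kinetic equation, with Knudsen number $\varepsilon>0$, is $\varepsilon^\alpha\partial_t f+\varepsilon v\cdot\nabla_x f=\rho M_\beta-f$ with $\rho(t,x)=\langle f(t,x,v)\rangle$, initial condition $f(0,x,v)=f_0(x,v)$ and periodic boundary conditions in the space variable $x$ in a bounded domain $\Omega\subset\mathbb{R}^d$. Hats denote the Fourier transform in $x$, with Fourier variable $k$; $\hat f_0$ is the Fourier transform of $f_0$ in $x$ and $\hat\rho^0(k)=\langle\hat f_0(k,\cdot)\rangle$. The time discretization is $t_n=n\Delta t$, $n=0,\dots,N$, with $N\Delta t=T$ the final time, and $\hat f^n\simeq\hat f(t_n)$, $\hat\rho^n\simeq\hat\rho(t_n)$. A scheme is Asymptotic Preserving (AP) if, for arbitrary initial condition $f_0$, it is consistent with the kinetic equation when $\Delta t\to0$ with $\varepsilon$ fixed, and it degenerates into a scheme solving the asymptotic equation when $\varepsilon\to0$ with $\Delta t$ fixed; here the asymptotic equation is the diffusion equation $\partial_t\hat\rho(t,k)=-\langle(k\cdot v)^2M_\beta(v)\rangle\hat\rho(t,k)$.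
   Formalization: Order 1 is proved for initial data f_0 with |v|^2 f_0 integrable over Ω×R^d (without velocity moments first order in L^1_v fails), and exact solutions of the kinetic equation are classical (C^1 in t and x) on a periodic box. *)

theory Defs
  imports "HOL-Analysis.Analysis"
begin

section \<open>Periodic domain and Fourier coefficients\<close>

text \<open>The spatial domain is the periodic box with side lengths \<open>L $ i\<close>; the Fourier variable then
  ranges over the dual lattice.\<close>

definition cell :: "real ^ 'd \<Rightarrow> (real ^ 'd) set"
  where "cell L = cbox 0 L"

definition dual_lattice :: "real ^ 'd \<Rightarrow> (real ^ 'd) set"
  where "dual_lattice L = {k. \<forall>i. \<exists>m::int. k $ i * L $ i = 2 * pi * of_int m}"

definition x_periodic :: "real ^ 'd \<Rightarrow> (real ^ 'd \<Rightarrow> real ^ 'd \<Rightarrow> real) \<Rightarrow> bool"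
  where "x_periodic L g \<longleftrightarrow> (\<forall>i x v. g (x + axis i (L $ i)) v = g x v)"

definition fourier_coeff :: "real ^ 'd \<Rightarrow> (real ^ 'd \<Rightarrow> real) \<Rightarrow> real ^ 'd \<Rightarrow> complex"
  where "fourier_coeff L g k =
    (LINT x:cell L|lborel. exp (- \<i> * of_real (k \<bullet> x)) * of_real (g x))
      / of_real (\<Prod>i\<in>UNIV. L $ i)"

definition fourier_x ::
    "real ^ 'd \<Rightarrow> (real ^ 'd \<Rightarrow> real ^ 'd \<Rightarrow> real) \<Rightarrow> real ^ 'd \<Rightarrow> real ^ 'd \<Rightarrow> complex"
  where "fourier_x L g k v = fourier_coeff L (\<lambda>x. g x v) k"

definition density :: "(real ^ 'd \<Rightarrow> real ^ 'd \<Rightarrow> real) \<Rightarrow> real ^ 'd \<Rightarrow> real"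
  where "density g x = (LINT v|lborel. g x v)"

section \<open>The kinetic equation in the diffusion scaling\<close>

definition initial_datum :: "real ^ 'd \<Rightarrow> (real ^ 'd \<Rightarrow> real ^ 'd \<Rightarrow> real) \<Rightarrow> bool"
  where "initial_datum L f0 \<longleftrightarrow>
    x_periodic L f0 \<and> set_integrable lborel (cell L \<times> UNIV) (\<lambda>(x, v). f0 x v)"

definition finite_second_moment :: "real ^ 'd \<Rightarrow> (real ^ 'd \<Rightarrow> real ^ 'd \<Rightarrow> real) \<Rightarrow> bool"
  where "finite_second_moment L f0 \<longleftrightarrow>
    set_integrable lborel (cell L \<times> UNIV) (\<lambda>(x, v). (norm v)\<^sup>2 * f0 x v)"

text \<open>Classical solutions on \<open>[0, T]\<close>: for each velocity, \<open>f\<close> is continuously differentiable in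
  \<open>(t, x)\<close>, with time derivative \<open>ft\<close> and spatial gradient \<open>fx\<close>.\<close>

definition kinetic_solution ::
    "real ^ 'd \<Rightarrow> (real ^ 'd \<Rightarrow> real) \<Rightarrow> real \<Rightarrow> real \<Rightarrow> (real ^ 'd \<Rightarrow> real ^ 'd \<Rightarrow> real)
      \<Rightarrow> (real \<Rightarrow> real ^ 'd \<Rightarrow> real ^ 'd \<Rightarrow> real) \<Rightarrow> bool"
  where "kinetic_solution L M T \<epsilon> f0 f \<longleftrightarrow>
    f 0 = f0 \<and>
    (\<forall>t\<in>{0..T}. x_periodic L (f t)
       \<and> set_integrable lborel (cell L \<times> UNIV) (\<lambda>(x, v). f t x v)
       \<and> (\<forall>x. integrable lborel (f t x))) \<and>
    (\<forall>v. \<exists>(ft :: real \<times> (real ^ 'd) \<Rightarrow> real) (fx :: real \<times> (real ^ 'd) \<Rightarrow> real ^ 'd).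
       continuous_on ({0..T} \<times> UNIV) ft \<and> continuous_on ({0..T} \<times> UNIV) fx \<and>
       (\<forall>t\<in>{0..T}. \<forall>x.
          ((\<lambda>(s, y). f s y v) has_derivative (\<lambda>(s, y). ft (t, x) * s + fx (t, x) \<bullet> y))
            (at (t, x) within {0..T} \<times> UNIV) \<and>
          \<epsilon>\<^sup>2 * ft (t, x) + \<epsilon> * (v \<bullet> fx (t, x)) = density (f t) x * M v - f t x v))"

section \<open>The scheme\<close>

definition lam :: "real \<Rightarrow> real \<Rightarrow> real"
  where "lam \<epsilon> dt = dt / (\<epsilon>\<^sup>2 + dt)"

definition transport :: "real \<Rightarrow> real \<Rightarrow> real ^ 'd \<Rightarrow> real ^ 'd \<Rightarrow> complex"
  where "transport \<epsilon> dt k v = \<i> * of_real (lam \<epsilon> dt * \<epsilon> * (k \<bullet> v))"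

definition rho_update ::
    "(real ^ 'd \<Rightarrow> real) \<Rightarrow> real \<Rightarrow> real \<Rightarrow> real ^ 'd \<Rightarrow> (real ^ 'd \<Rightarrow> complex) \<Rightarrow> complex"
  where "rho_update M \<epsilon> dt k g =
    (LINT v|lborel. g v / (1 + transport \<epsilon> dt k v)) *
    inverse ((LINT v|lborel. of_real (M v) / (1 + transport \<epsilon> dt k v))
      + 1 / of_real (1 - lam \<epsilon> dt) *
        (LINT v|lborel. transport \<epsilon> dt k v * of_real (M v) / (1 + transport \<epsilon> dt k v)))"

text \<open>The argument \<open>g\<close> below is the initial value (in Fourier variables), the \<open>nat\<close> argument the time
  index.\<close>

primrec scheme_f ::
    "(real ^ 'd \<Rightarrow> real) \<Rightarrow> real \<Rightarrow> real \<Rightarrow> (real ^ 'd \<Rightarrow> real ^ 'd \<Rightarrow> complex)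
      \<Rightarrow> nat \<Rightarrow> real ^ 'd \<Rightarrow> real ^ 'd \<Rightarrow> complex"
  where
    "scheme_f M \<epsilon> dt g 0 = g"
  | "scheme_f M \<epsilon> dt g (Suc n) = (\<lambda>k v.
       1 / (1 + transport \<epsilon> dt k v) *
       (of_real (1 - lam \<epsilon> dt) * scheme_f M \<epsilon> dt g n k v
        + of_real (lam \<epsilon> dt) * rho_update M \<epsilon> dt k (scheme_f M \<epsilon> dt g n k) * of_real (M v)))"

primrec scheme_rho ::
    "(real ^ 'd \<Rightarrow> real) \<Rightarrow> real \<Rightarrow> real \<Rightarrow> (real ^ 'd \<Rightarrow> real ^ 'd \<Rightarrow> complex)
      \<Rightarrow> nat \<Rightarrow> real ^ 'd \<Rightarrow> complex"
  where
    "scheme_rho M \<epsilon> dt g 0 = (\<lambda>k. LINT v|lborel. g k v)"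
  | "scheme_rho M \<epsilon> dt g (Suc n) = (\<lambda>k. rho_update M \<epsilon> dt k (scheme_f M \<epsilon> dt g n k))"

section \<open>Order of accuracy and the Asymptotic Preserving property\<close>

text \<open>In this section \<open>fs\<close> and \<open>rs\<close> are the \<open>f\<close>- and \<open>\<rho>\<close>-components of an arbitrary one-step scheme,
  with arguments \<open>\<epsilon>\<close>, time step, initial value, time index and Fourier variable. One step started
  from \<open>g\<close> is \<open>fs \<epsilon> dt g 1\<close>.\<close>

type_synonym 'd f_scheme =
  "real \<Rightarrow> real \<Rightarrow> (real ^ 'd \<Rightarrow> real ^ 'd \<Rightarrow> complex) \<Rightarrow> nat \<Rightarrow> real ^ 'd \<Rightarrow> real ^ 'd \<Rightarrow> complex"

type_synonym 'd rho_scheme =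
  "real \<Rightarrow> real \<Rightarrow> (real ^ 'd \<Rightarrow> real ^ 'd \<Rightarrow> complex) \<Rightarrow> nat \<Rightarrow> real ^ 'd \<Rightarrow> complex"

text \<open>An extended nonnegative integral, so that a bound on it also excludes non-integrability.\<close>

definition L1_dist :: "(real ^ 'd \<Rightarrow> complex) \<Rightarrow> (real ^ 'd \<Rightarrow> complex) \<Rightarrow> ennreal"
  where "L1_dist g h = (\<integral>\<^sup>+ v. ennreal (cmod (g v - h v)) \<partial>lborel)"

text \<open>Order \<open>p\<close>, at a fixed \<open>\<epsilon>\<close>: for each Fourier mode the local error of one step started from the
  exact solution is \<open>O(dt ^ (p + 1))\<close> and the global error on \<open>[0, T]\<close> is \<open>O(dt ^ p)\<close>, both uniformly
  in time.\<close>

definition accurate_of_order ::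
    "nat \<Rightarrow> real ^ 'd \<Rightarrow> (real ^ 'd \<Rightarrow> real) \<Rightarrow> real \<Rightarrow> real \<Rightarrow> 'd f_scheme \<Rightarrow> 'd rho_scheme
      \<Rightarrow> (real ^ 'd \<Rightarrow> real ^ 'd \<Rightarrow> real) \<Rightarrow> bool"
  where "accurate_of_order p L M T \<epsilon> fs rs f0 \<longleftrightarrow>
    (\<forall>f. kinetic_solution L M T \<epsilon> f0 f \<longrightarrow> (\<forall>k\<in>dual_lattice L. \<exists>C.
      (\<forall>t dt. 0 \<le> t \<and> 0 < dt \<and> t + dt \<le> T \<longrightarrow>
         L1_dist (fs \<epsilon> dt (fourier_x L (f t)) 1 k) (fourier_x L (f (t + dt)) k)
           \<le> ennreal (C * dt ^ (p + 1))) \<and>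
      (\<forall>N\<ge>1. \<forall>n\<le>N. let dt = T / real N; t = real n * dt in
         L1_dist (fs \<epsilon> dt (fourier_x L f0) n k) (fourier_x L (f t) k) \<le> ennreal (C * dt ^ p) \<and>
         cmod (rs \<epsilon> dt (fourier_x L f0) n k - fourier_coeff L (density (f t)) k) \<le> C * dt ^ p)))"

text \<open>Consistency with the kinetic equation as \<open>dt \<rightarrow> 0\<close> at fixed \<open>\<epsilon>\<close>, for data without any velocity
  moments: the truncation error vanishes (for each velocity, since \<open>t \<mapsto> f t\<close> need then not be
  differentiable with values in L1) and the numerical solution converges on \<open>[0, T]\<close>.\<close>

definition consistent_kinetic ::
    "real ^ 'd \<Rightarrow> (real ^ 'd \<Rightarrow> real) \<Rightarrow> real \<Rightarrow> real \<Rightarrow> 'd f_scheme \<Rightarrow> 'd rho_scheme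
      \<Rightarrow> (real ^ 'd \<Rightarrow> real ^ 'd \<Rightarrow> real) \<Rightarrow> bool"
  where "consistent_kinetic L M T \<epsilon> fs rs f0 \<longleftrightarrow>
    (\<forall>f. kinetic_solution L M T \<epsilon> f0 f \<longrightarrow> (\<forall>k\<in>dual_lattice L.
      (\<forall>t v. 0 \<le> t \<and> t < T \<longrightarrow>
         ((\<lambda>dt. (fourier_x L (f (t + dt)) k v - fs \<epsilon> dt (fourier_x L (f t)) 1 k v) / of_real dt)
            \<longlongrightarrow> 0) (at_right 0)) \<and>
      (\<forall>\<eta>>0. \<exists>N0\<ge>1. \<forall>N\<ge>N0. \<forall>n\<le>N. let dt = T / real N; t = real n * dt in
         L1_dist (fs \<epsilon> dt (fourier_x L f0) n k) (fourier_x L (f t) k) \<le> ennreal \<eta> \<and>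
         cmod (rs \<epsilon> dt (fourier_x L f0) n k - fourier_coeff L (density (f t)) k) \<le> \<eta>)))"

definition diffusion_coeff :: "(real ^ 'd \<Rightarrow> real) \<Rightarrow> real ^ 'd \<Rightarrow> real"
  where "diffusion_coeff M k = (LINT v|lborel. (k \<bullet> v)\<^sup>2 * M v)"

definition diffusion_solution ::
    "(real ^ 'd \<Rightarrow> real) \<Rightarrow> real \<Rightarrow> real ^ 'd \<Rightarrow> complex \<Rightarrow> (real \<Rightarrow> complex) \<Rightarrow> bool"
  where "diffusion_solution M T k u0 u \<longleftrightarrow> u 0 = u0 \<and>
    (\<forall>t\<in>{0..T}. (u has_vector_derivative - of_real (diffusion_coeff M k) * u t)
       (at t within {0..T}))"

text \<open>Here \<open>r N n\<close> is the limit as \<open>\<epsilon> \<rightarrow> 0\<close>, at the fixed time step \<open>T / N\<close>, of the density at time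
  index \<open>n\<close>; the limit scheme has to converge to the solution of the diffusion equation.\<close>

definition degenerates_to_diffusion ::
    "real ^ 'd \<Rightarrow> (real ^ 'd \<Rightarrow> real) \<Rightarrow> real \<Rightarrow> 'd rho_scheme
      \<Rightarrow> (real ^ 'd \<Rightarrow> real ^ 'd \<Rightarrow> real) \<Rightarrow> bool"
  where "degenerates_to_diffusion L M T rs f0 \<longleftrightarrow>
    (\<forall>k\<in>dual_lattice L. \<exists>r :: nat \<Rightarrow> nat \<Rightarrow> complex.
      (\<forall>N\<ge>1. \<forall>n\<le>N.
         ((\<lambda>\<epsilon>. rs \<epsilon> (T / real N) (fourier_x L f0) n k) \<longlongrightarrow> r N n) (at_right 0)) \<and>
      (\<forall>u. diffusion_solution M T k (fourier_coeff L (density f0) k) u \<longrightarrow>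
         (\<forall>\<eta>>0. \<exists>N0\<ge>1. \<forall>N\<ge>N0. \<forall>n\<le>N. cmod (r N n - u (real n * (T / real N))) \<le> \<eta>)))"

definition asymptotic_preserving ::
    "real ^ 'd \<Rightarrow> (real ^ 'd \<Rightarrow> real) \<Rightarrow> real \<Rightarrow> 'd f_scheme \<Rightarrow> 'd rho_scheme \<Rightarrow> bool"
  where "asymptotic_preserving L M T fs rs \<longleftrightarrow>
    (\<forall>f0. initial_datum L f0 \<longrightarrow>
      (\<forall>\<epsilon>>0. consistent_kinetic L M T \<epsilon> fs rs f0) \<and> degenerates_to_diffusion L M T rs f0)"

end

theory Submission
  imports Defs
begin

text \<open>Despite its explicit form, the scheme is the implicit Euler method applied to each Fourier mode.
  After multiplication by \<open>\<epsilon>\<^sup>2 + dt\<close>, the update of \<open>f\<close> reads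
  \<open>(\<epsilon>\<^sup>2 + dt + \<i> dt \<epsilon> k \<bullet> v) F' = \<epsilon>\<^sup>2 F + dt P M\<close>
  (\<open>euler_step_eq\<close>), and the formula for the new density \<open>P\<close> is precisely the solution of the
  compatibility condition \<open>\<langle>F'\<rangle> = P\<close> (\<open>integral_euler_step\<close>). Because \<open>M\<close> is nonnegative with mass \<open>1\<close>,
  this implicit step is a contraction of \<open>L\<^sup>1\<close> in velocity, for every \<open>\<epsilon>\<close> and \<open>dt\<close>
  (\<open>implicit_euler_estimate\<close>). Mass conservation is the compatibility condition at \<open>k = 0\<close>.

  For the order, the Fourier mode of a classical solution is shown to satisfy the ordinary
  differential equation being discretized (\<open>fourier_mode_ode\<close>) and to be dominated, uniformly in time,
  by the initial mode plus a multiple of \<open>M\<close> (\<open>mode_envelope\<close>). Second moments then bound the residual of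
  an Euler step by \<open>dt\<^sup>2\<close>, and contractivity adds up the residuals (\<open>step_error\<close>). Without moments, the
  same estimate is applied to the solution truncated to \<open>\<bar>k \<bullet> v\<bar> \<le> m\<close>: truncation creates an extra error
  proportional to the mass of the tail, and letting \<open>dt \<rightarrow> 0\<close> before \<open>m \<rightarrow> \<infinity>\<close> gives convergence for every
  integrable datum.

  For \<open>\<epsilon> \<rightarrow> 0\<close> at fixed \<open>dt\<close>, the denominator in the density update is expanded to second order
  in the transport symbol; the first moment of \<open>M\<close> vanishes and the second moment survives with the
  factor \<open>dt\<close>, so that the denominator tends to \<open>1 + dt D\<close>, where \<open>D\<close> is the diffusion coefficient
  (\<open>denom_tendsto\<close>). The numerator tends to the previous density (\<open>scheme_diffusive_limit\<close>). The limit is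
  thus \<open>\<rho>\<^sup>n\<^sup>+\<^sup>1 = \<rho>\<^sup>n / (1 + dt D)\<close>, implicit Euler for the diffusion equation, which converges to its
  solution \<open>exp (-D t) \<rho>\<^sup>0\<close>.\<close>

section \<open>The scheme as a contractive implicit Euler method\<close>

lemma lam_pos: "0 < \<epsilon> \<Longrightarrow> 0 < dt \<Longrightarrow> 0 < lam \<epsilon> dt"
  by (simp add: lam_def add_pos_pos)

lemma lam_compl: "0 < \<epsilon> \<Longrightarrow> 0 < dt \<Longrightarrow> 1 - lam \<epsilon> dt = \<epsilon>\<^sup>2 / (\<epsilon>\<^sup>2 + dt)"
  by (simp add: lam_def field_simps add_pos_pos less_imp_neq[symmetric])

lemma one_plus_imaginary_nonzero [simp]: "1 + \<i> * of_real x \<noteq> 0"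
  by (simp add: complex_eq_iff)

lemma cmod_one_plus_imaginary_ge: "1 \<le> cmod (1 + \<i> * of_real x)"
  using complex_Re_le_cmod[of "1 + \<i> * of_real x"] by simp

lemma cmod_divide_one_plus_imaginary_le: "cmod (z / (1 + \<i> * of_real x) ^ m) \<le> cmod z"
proof -
  have "1 \<le> cmod (1 + \<i> * of_real x) ^ m"
    by (intro one_le_power cmod_one_plus_imaginary_ge)
  then have "cmod z / cmod (1 + \<i> * of_real x) ^ m \<le> cmod z"
    using mult_left_mono[of 1 _ "cmod z"] by (subst pos_divide_le_eq) auto
  then show ?thesis by (simp only: norm_divide norm_power)
qed

lemma one_plus_transport_nonzero [simp]: "1 + transport \<epsilon> dt k v \<noteq> 0"
  unfolding transport_def by (rule one_plus_imaginary_nonzero)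

text \<open>Clearing the factor \<open>\<epsilon>\<^sup>2 + dt\<close> from the definition of \<open>\<lambda>\<close> reveals the symbol of the
  operator \<open>\<epsilon>\<^sup>2 + dt * (1 + \<epsilon> v \<bullet> \<nabla>)\<close>, that is, of an implicit Euler step.\<close>

lemma euler_coefficient:
  assumes "0 < \<epsilon>" "0 < dt"
  shows "of_real (\<epsilon>\<^sup>2 + dt) * (1 + transport \<epsilon> dt k v)
    = of_real (\<epsilon>\<^sup>2) + of_real dt * (1 + \<i> * of_real (\<epsilon> * (k \<bullet> v)))"
proof -
  have "\<epsilon>\<^sup>2 + dt \<noteq> 0" using assms by (simp add: add_pos_pos less_imp_neq[symmetric])
  then have "(\<epsilon>\<^sup>2 + dt) * (lam \<epsilon> dt * \<epsilon> * (k \<bullet> v)) = dt * (\<epsilon> * (k \<bullet> v))"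
    by (simp add: lam_def)
  then show ?thesis by (simp add: transport_def complex_eq_iff del: of_real_add)
qed

lemma integrable_resolvent:
  fixes F :: "real ^ 'd \<Rightarrow> complex"
  assumes "integrable lborel F"
  shows "integrable lborel (\<lambda>v. F v / (1 + \<i> * of_real (c * (k \<bullet> v))) ^ m)"
proof (rule Bochner_Integration.integrable_bound[OF assms])
  have [measurable]: "F \<in> borel_measurable borel"
    using borel_measurable_integrable[OF assms] by simp
  show "(\<lambda>v. F v / (1 + \<i> * of_real (c * (k \<bullet> v))) ^ m) \<in> borel_measurable lborel"
    by simp
  show "AE v in lborel. norm (F v / (1 + \<i> * of_real (c * (k \<bullet> v))) ^ m) \<le> norm (F v)"
    by (intro always_eventually allI cmod_divide_one_plus_imaginary_le)
qed

lemma integrable_transport_resolvent: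
  fixes F :: "real ^ 'd \<Rightarrow> complex"
  assumes "integrable lborel F"
  shows "integrable lborel (\<lambda>v. F v / (1 + transport \<epsilon> dt k v))"
  using integrable_resolvent[OF assms, of "lam \<epsilon> dt * \<epsilon>" k 1]
  by (simp add: transport_def mult.assoc)

text \<open>Both limits taken later, \<open>dt \<rightarrow> 0\<close> at fixed \<open>\<epsilon>\<close> and \<open>\<epsilon> \<rightarrow> 0\<close> at fixed \<open>dt\<close>, send the number
  \<open>c = \<lambda>\<epsilon>\<close> to \<open>0\<close>. The resolvents are bounded by \<open>1\<close>, so \<open>\<bar>F\<bar>\<close> dominates the integrands and both limits hold
  for an arbitrary integrable \<open>F\<close>.\<close>

lemma integral_resolvent_tendsto:
  fixes F :: "real ^ 'd \<Rightarrow> complex"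
  assumes F: "integrable lborel F" and c: "(c \<longlongrightarrow> 0) A"
  shows "((\<lambda>x. LINT v|lborel. F v / (1 + \<i> * of_real (c x * (k \<bullet> v))) ^ m) \<longlongrightarrow> (LINT v|lborel. F v)) A"
proof -
  let ?I = "\<lambda>c. LINT v|lborel. F v / (1 + \<i> * of_real (c * (k \<bullet> v))) ^ m"
  have [measurable]: "F \<in> borel_measurable borel"
    using borel_measurable_integrable[OF F] by simp
  have "(?I \<longlongrightarrow> ?I 0) (at 0)"
    unfolding tendsto_at_iff_sequentially o_def
  proof (intro allI impI)
    fix X :: "nat \<Rightarrow> real" assume X: "X \<longlonglongrightarrow> 0"
    show "(\<lambda>i. ?I (X i)) \<longlonglongrightarrow> ?I 0"
    proof (rule integral_dominated_convergence[where w="\<lambda>v. cmod (F v)"])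
      show "integrable lborel (\<lambda>v. cmod (F v))" using F by simp
      show "AE v in lborel. (\<lambda>i. F v / (1 + \<i> * of_real (X i * (k \<bullet> v))) ^ m)
          \<longlonglongrightarrow> F v / (1 + \<i> * of_real (0 * (k \<bullet> v))) ^ m"
        by (intro always_eventually allI tendsto_intros X) simp
      show "AE v in lborel. norm (F v / (1 + \<i> * of_real (X i * (k \<bullet> v))) ^ m) \<le> cmod (F v)" for i
        by (intro always_eventually allI cmod_divide_one_plus_imaginary_le)
    qed auto
  qed
  then have "isCont ?I 0" by (simp add: isCont_def)
  from isCont_tendsto_compose[OF this c] show ?thesis by simp
qed

text \<open>The only stability estimate of the proof. Since the left-hand symbol has modulus at least
  \<open>\<epsilon>\<^sup>2 + dt\<close> and \<open>M\<close> has mass \<open>1\<close>, integrating the modulus of the equation gives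
  \<open>(\<epsilon>\<^sup>2 + dt) |E'| \<le> \<epsilon>\<^sup>2 |E| + dt |P| + |q|\<close> in \<open>L\<^sup>1\<close>; when \<open>P\<close> is, up to \<open>p\<close>, the mass of \<open>E'\<close>, the
  relaxation term \<open>dt |P|\<close> is absorbed on the left. With \<open>p = 0\<close> and \<open>q = 0\<close> this is contractivity,
  uniformly in \<open>\<epsilon>\<close>; with a residual \<open>q\<close> it propagates errors.\<close>

lemma implicit_euler_estimate:
  fixes E E' :: "real ^ 'd \<Rightarrow> complex" and M B :: "real ^ 'd \<Rightarrow> real" and q :: "real ^ 'd \<Rightarrow> complex"
  assumes \<epsilon>: "0 < \<epsilon>" and dt: "0 < dt"
    and M: "integrable lborel M" "\<And>v. 0 \<le> M v" "(LINT v|lborel. M v) = 1"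
    and E: "integrable lborel E" and E': "integrable lborel E'" and B: "integrable lborel B"
    and eq: "\<And>v. of_real (\<epsilon>\<^sup>2 + dt) * (1 + transport \<epsilon> dt k v) * E' v
        = of_real (\<epsilon>\<^sup>2) * E v + of_real dt * P * of_real (M v) + q v"
    and q: "\<And>v. cmod (q v) \<le> B v"
    and P: "cmod P \<le> (LINT v|lborel. cmod (E' v)) + p"
  shows "\<epsilon>\<^sup>2 * (LINT v|lborel. cmod (E' v))
    \<le> \<epsilon>\<^sup>2 * (LINT v|lborel. cmod (E v)) + dt * p + (LINT v|lborel. B v)"
proof -
  have pos: "0 < \<epsilon>\<^sup>2 + dt" using \<epsilon> dt by (simp add: add_pos_pos)
  have pt: "(\<epsilon>\<^sup>2 + dt) * cmod (E' v) \<le> \<epsilon>\<^sup>2 * cmod (E v) + dt * cmod P * M v + B v" for v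
  proof -
    have "(\<epsilon>\<^sup>2 + dt) * 1 * cmod (E' v)
        \<le> (\<epsilon>\<^sup>2 + dt) * cmod (1 + transport \<epsilon> dt k v) * cmod (E' v)"
      unfolding transport_def using pos
      by (intro mult_right_mono mult_left_mono cmod_one_plus_imaginary_ge) auto
    also have "\<dots> = cmod (of_real (\<epsilon>\<^sup>2 + dt) * (1 + transport \<epsilon> dt k v) * E' v)"
      using pos by (simp add: norm_mult del: of_real_add)
    also have "\<dots> \<le> cmod (of_real (\<epsilon>\<^sup>2) * E v) + cmod (of_real dt * P * of_real (M v)) + cmod (q v)"
      unfolding eq by (intro norm_triangle_le add_mono norm_triangle_ineq order_refl)
    also have "\<dots> \<le> \<epsilon>\<^sup>2 * cmod (E v) + dt * cmod P * M v + B v"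
      using dt M(2)[of v] q[of v] by (simp add: norm_mult norm_power)
    finally show ?thesis by simp
  qed
  have "(\<epsilon>\<^sup>2 + dt) * (LINT v|lborel. cmod (E' v)) = (LINT v|lborel. (\<epsilon>\<^sup>2 + dt) * cmod (E' v))"
    by simp
  also have "\<dots> \<le> (LINT v|lborel. \<epsilon>\<^sup>2 * cmod (E v) + dt * cmod P * M v + B v)"
    using M E E' B pt by (intro integral_mono) auto
  also have "\<dots> = \<epsilon>\<^sup>2 * (LINT v|lborel. cmod (E v)) + dt * cmod P + (LINT v|lborel. B v)"
    using M E B by simp
  also have "dt * cmod P \<le> dt * ((LINT v|lborel. cmod (E' v)) + p)"
    using dt P by simp
  finally show ?thesis by (simp add: algebra_simps)
qed

locale equilibrium =
  fixes M :: "real ^ 'd \<Rightarrow> real"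
  assumes M_int: "integrable lborel M" and M_nonneg: "\<And>v. 0 \<le> M v"
    and M_mass: "(LINT v|lborel. M v) = 1"
begin

abbreviation "denom \<epsilon> dt k \<equiv> (LINT v|lborel. of_real (M v) / (1 + transport \<epsilon> dt k v))
      + 1 / of_real (1 - lam \<epsilon> dt) *
        (LINT v|lborel. transport \<epsilon> dt k v * of_real (M v) / (1 + transport \<epsilon> dt k v))"

lemma integral_M_complex: "(LINT v|lborel. complex_of_real (M v)) = 1"
  using M_mass by simp

lemma transport_part_eq:
  "(LINT v|lborel. transport \<epsilon> dt k v * of_real (M v) / (1 + transport \<epsilon> dt k v))
    = 1 - (LINT v|lborel. of_real (M v) / (1 + transport \<epsilon> dt k v))"
proof -
  have "transport \<epsilon> dt k v * of_real (M v) / (1 + transport \<epsilon> dt k v)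
      = of_real (M v) - of_real (M v) / (1 + transport \<epsilon> dt k v)" for v
    by (simp add: field_simps)
  then show ?thesis
    using M_int M_mass integrable_transport_resolvent[of "\<lambda>v. of_real (M v)" \<epsilon> dt k] by simp
qed

text \<open>Writing \<open>A\<close> for the first integral, the denominator is \<open>A + s (1 - A)\<close> with \<open>s = 1 / (1 - \<lambda>) \<ge> 1\<close>
  and \<open>Re A \<le> 1\<close>, so its real part is at least \<open>1\<close>.\<close>

lemma denom_nonzero:
  assumes "0 < \<epsilon>" "0 < dt"
  shows "denom \<epsilon> dt k \<noteq> 0"
proof -
  let ?A = "LINT v|lborel. of_real (M v) / (1 + transport \<epsilon> dt k v)"
  have int: "integrable lborel (\<lambda>v. of_real (M v) / (1 + transport \<epsilon> dt k v))"
    using M_int by (intro integrable_transport_resolvent) simp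
  have "Re ?A = (LINT v|lborel. Re (of_real (M v) / (1 + transport \<epsilon> dt k v)))"
    using int by simp
  also have "\<dots> \<le> (LINT v|lborel. M v)"
  proof (rule integral_mono)
    fix v
    have "Re (of_real (M v) / (1 + transport \<epsilon> dt k v)) \<le> cmod (of_real (M v) / (1 + transport \<epsilon> dt k v))"
      by (rule complex_Re_le_cmod)
    also have "\<dots> \<le> cmod (of_real (M v))"
      unfolding transport_def
      using cmod_divide_one_plus_imaginary_le[of "of_real (M v)" _ 1] by (simp only: power_one_right)
    also have "\<dots> = M v" using M_nonneg[of v] by simp
    finally show "Re (of_real (M v) / (1 + transport \<epsilon> dt k v)) \<le> M v" by simp
  qed (use int M_int in auto)
  finally have le: "Re ?A \<le> 1" using M_mass by simp
  let ?s = "1 / (1 - lam \<epsilon> dt)"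
  have l: "0 < 1 - lam \<epsilon> dt" "1 - lam \<epsilon> dt \<le> 1"
    using assms lam_pos[of \<epsilon> dt] lam_compl[of \<epsilon> dt] by (auto simp: add_pos_pos)
  then have s: "1 \<le> ?s" by simp
  have "Re (denom \<epsilon> dt k) = Re ?A + ?s * (1 - Re ?A)"
  proof -
    have "Re (z + 1 / complex_of_real a * (1 - z)) = Re z + 1 / a * (1 - Re z)" for z a
      by (simp add: Re_divide_of_real)
    then show ?thesis unfolding transport_part_eq .
  qed
  also have "\<dots> \<ge> Re ?A + 1 * (1 - Re ?A)"
    using s le by (intro add_left_mono mult_right_mono) auto
  finally have "1 \<le> Re (denom \<epsilon> dt k)" by simp
  then show ?thesis by (metis not_one_le_zero zero_complex.simps(1))
qed

definition euler_step :: "real \<Rightarrow> real \<Rightarrow> real ^ 'd \<Rightarrow> (real ^ 'd \<Rightarrow> complex) \<Rightarrow> real ^ 'd \<Rightarrow> complex" where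
  "euler_step \<epsilon> dt k F v = 1 / (1 + transport \<epsilon> dt k v) *
     (of_real (1 - lam \<epsilon> dt) * F v + of_real (lam \<epsilon> dt) * rho_update M \<epsilon> dt k F * of_real (M v))"

lemma scheme_f_Suc: "scheme_f M \<epsilon> dt g (Suc n) k = euler_step \<epsilon> dt k (scheme_f M \<epsilon> dt g n k)"
  by (simp add: euler_step_def fun_eq_iff)

text \<open>This form of the step, the one used everywhere below, says that \<open>F' = euler_step \<epsilon> dt k F\<close>
  solves \<open>\<epsilon>\<^sup>2 (F' - F) / dt = P M - (1 + \<i> \<epsilon> k \<bullet> v) F'\<close> with the updated density \<open>P\<close>.\<close>

lemma euler_step_eq:
  assumes "0 < \<epsilon>" "0 < dt"
  shows "of_real (\<epsilon>\<^sup>2 + dt) * (1 + transport \<epsilon> dt k v) * euler_step \<epsilon> dt k F v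
    = of_real (\<epsilon>\<^sup>2) * F v + of_real dt * rho_update M \<epsilon> dt k F * of_real (M v)"
proof -
  have ne: "\<epsilon>\<^sup>2 + dt \<noteq> 0" using assms by (simp add: add_pos_pos less_imp_neq[symmetric])
  have 1: "complex_of_real (\<epsilon>\<^sup>2 + dt) * of_real (1 - lam \<epsilon> dt) = of_real (\<epsilon>\<^sup>2)"
    unfolding of_real_mult[symmetric] lam_compl[OF assms] using ne by simp
  have 2: "complex_of_real (\<epsilon>\<^sup>2 + dt) * of_real (lam \<epsilon> dt) = of_real dt"
    unfolding of_real_mult[symmetric] lam_def using ne by simp
  have "of_real (\<epsilon>\<^sup>2 + dt) * (1 + transport \<epsilon> dt k v) * euler_step \<epsilon> dt k F v
    = (complex_of_real (\<epsilon>\<^sup>2 + dt) * of_real (1 - lam \<epsilon> dt)) * F v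
     + (complex_of_real (\<epsilon>\<^sup>2 + dt) * of_real (lam \<epsilon> dt)) * rho_update M \<epsilon> dt k F * of_real (M v)"
    (is "?a * ?T * _ = ?a * ?b * _ + ?a * ?c * _ * _")
  proof -
    have "a * t * (1 / t * (b * x + c * y * z)) = a * b * x + a * c * y * z"
      if "t \<noteq> 0" for a b c t x y z :: complex
      using that by (simp add: field_simps)
    from this[OF one_plus_transport_nonzero] show ?thesis unfolding euler_step_def .
  qed
  then show ?thesis unfolding 1 2 .
qed

lemma integrable_euler_step:
  assumes "integrable lborel F"
  shows "integrable lborel (euler_step \<epsilon> dt k F)"
  unfolding euler_step_def[abs_def]
  using integrable_transport_resolvent[of "\<lambda>v. of_real (1 - lam \<epsilon> dt) * F v
     + of_real (lam \<epsilon> dt) * rho_update M \<epsilon> dt k F * of_real (M v)" \<epsilon> dt k] assms M_int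
  by simp

text \<open>The formula for the density is exactly what makes the density of the new distribution equal
  to the value \<open>P\<close> in its equation: integrating the step and using \<open>\<langle>M\<rangle> = 1\<close> turns the requirement
  \<open>\<langle>F'\<rangle> = P\<close> into a scalar equation whose solution is \<^const>\<open>rho_update\<close>. So the scheme is a
  genuine implicit Euler step, and its density is not an independent unknown.\<close>

lemma integral_euler_step:
  assumes F: "integrable lborel F" and pos: "0 < \<epsilon>" "0 < dt"
  shows "(LINT v|lborel. euler_step \<epsilon> dt k F v) = rho_update M \<epsilon> dt k F"
proof -
  let ?A = "LINT v|lborel. of_real (M v) / (1 + transport \<epsilon> dt k v)"
  let ?N = "LINT v|lborel. F v / (1 + transport \<epsilon> dt k v)"
  let ?l = "complex_of_real (lam \<epsilon> dt)"
  let ?R = "rho_update M \<epsilon> dt k F"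
  have "euler_step \<epsilon> dt k F v = (1 - ?l) * (F v / (1 + transport \<epsilon> dt k v))
      + ?l * ?R * (of_real (M v) / (1 + transport \<epsilon> dt k v))" for v
  proof -
    have "1 / t * ((1 - l) * x + l * y * z) = (1 - l) * (x / t) + l * y * (z / t)"
      for t l x y z :: complex
      by (simp add: add_divide_distrib)
    then show ?thesis unfolding euler_step_def of_real_diff of_real_1 .
  qed
  moreover have "integrable lborel (\<lambda>v. of_real (M v) / (1 + transport \<epsilon> dt k v))"
    using M_int by (intro integrable_transport_resolvent) simp
  ultimately have I: "(LINT v|lborel. euler_step \<epsilon> dt k F v) = (1 - ?l) * ?N + ?l * ?R * ?A"
    using integrable_transport_resolvent[OF F, of \<epsilon> dt k]
    by (simp add: Bochner_Integration.integral_add del: times_divide_eq_right times_divide_eq_left)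
  have l: "1 - ?l \<noteq> 0"
  proof -
    have "1 - lam \<epsilon> dt \<noteq> 0" using lam_compl[OF pos] pos by (simp add: add_pos_pos less_imp_neq[symmetric])
    then show ?thesis by (metis of_real_1 of_real_diff of_real_eq_0_iff)
  qed
  have D: "denom \<epsilon> dt k * (1 - ?l) = 1 - ?l * ?A"
  proof -
    have "(a + 1 / l * (1 - a)) * l = a * l + 1 - a" if "l \<noteq> 0" for a l :: complex
      using that by (simp add: field_simps)
    from this[OF l] have "denom \<epsilon> dt k * (1 - ?l) = ?A * (1 - ?l) + 1 - ?A"
      unfolding transport_part_eq of_real_diff of_real_1 .
    then show ?thesis by (simp add: algebra_simps)
  qed
  have "?R * denom \<epsilon> dt k = ?N"
    using denom_nonzero[OF pos, of k] by (simp add: rho_update_def)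
  then have "(1 - ?l) * ?N = ?R * (denom \<epsilon> dt k * (1 - ?l))" by (simp add: ac_simps)
  also have "\<dots> = ?R - ?l * ?R * ?A" unfolding D by (simp add: algebra_simps)
  finally show ?thesis unfolding I by simp
qed

lemma euler_step_contraction:
  assumes F: "integrable lborel F" and pos: "0 < \<epsilon>" "0 < dt"
  shows "(LINT v|lborel. cmod (euler_step \<epsilon> dt k F v)) \<le> (LINT v|lborel. cmod (F v))"
proof -
  have "\<epsilon>\<^sup>2 * (LINT v|lborel. cmod (euler_step \<epsilon> dt k F v))
      \<le> \<epsilon>\<^sup>2 * (LINT v|lborel. cmod (F v)) + dt * 0 + (LINT v|(lborel :: (real ^ 'd) measure). 0)"
  proof (rule implicit_euler_estimate[OF pos M_int M_nonneg M_mass F integrable_euler_step[OF F]])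
    show "cmod (rho_update M \<epsilon> dt k F) \<le> (LINT v|lborel. cmod (euler_step \<epsilon> dt k F v)) + 0"
      unfolding integral_euler_step[OF F pos, symmetric] by simp
  qed (use euler_step_eq[OF pos] in auto)
  then show ?thesis using pos by simp
qed

lemma integrable_scheme_f:
  "integrable lborel (g k) \<Longrightarrow> integrable lborel (scheme_f M \<epsilon> dt g n k)"
proof (induction n)
  case (Suc n)
  then show ?case unfolding scheme_f_Suc by (intro integrable_euler_step)
qed simp

lemma scheme_rho_eq_integral:
  assumes g: "integrable lborel (g k)" and pos: "0 < \<epsilon>" "0 < dt"
  shows "scheme_rho M \<epsilon> dt g n k = (LINT v|lborel. scheme_f M \<epsilon> dt g n k v)"
proof (cases n)
  case (Suc m)
  show ?thesis
    unfolding Suc scheme_f_Suc scheme_rho.simps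
    by (rule integral_euler_step[OF integrable_scheme_f[where g=g, OF g] pos, symmetric])
qed simp

lemma scheme_f_bounded:
  assumes g: "integrable lborel (g k)" and pos: "0 < \<epsilon>" "0 < dt"
  shows "(LINT v|lborel. cmod (scheme_f M \<epsilon> dt g n k v)) \<le> (LINT v|lborel. cmod (g k v))"
proof (induction n)
  case 0
  show ?case by simp
next
  case (Suc n)
  have i: "integrable lborel (scheme_f M \<epsilon> dt g n k)"
    by (rule integrable_scheme_f[where g=g, OF g])
  have "(LINT v|lborel. cmod (scheme_f M \<epsilon> dt g (Suc n) k v)) \<le> (LINT v|lborel. cmod (scheme_f M \<epsilon>
      dt g n k v))"
    unfolding scheme_f_Suc by (rule euler_step_contraction[OF i pos])
  also note Suc
  finally show ?case .
qed

text \<open>At \<open>k = 0\<close> the transport term vanishes, and the new density is the mass of the previous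
  distribution.\<close>

lemma mass_conservation:
  assumes g: "integrable lborel (g 0)" and pos: "0 < \<epsilon>" "0 < dt"
  shows "scheme_rho M \<epsilon> dt g n 0 = scheme_rho M \<epsilon> dt g 0 0"
proof (induction n)
  case (Suc n)
  have "scheme_rho M \<epsilon> dt g (Suc n) 0 = (LINT v|lborel. scheme_f M \<epsilon> dt g n 0 v)"
    using M_mass by (simp add: rho_update_def transport_def)
  also have "\<dots> = scheme_rho M \<epsilon> dt g n 0"
    by (rule scheme_rho_eq_integral[where g=g, OF g pos, symmetric])
  finally show ?case unfolding Suc .
qed simp

end

section \<open>Error estimates for a single Fourier mode\<close>

lemma has_vector_derivative_bound:
  fixes f :: "real \<Rightarrow> 'a::real_normed_vector"
  assumes "convex S" and "\<And>x. x \<in> S \<Longrightarrow> (f has_vector_derivative f' x) (at x within S)"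
    and "\<And>x. x \<in> S \<Longrightarrow> norm (f' x) \<le> B" and "x \<in> S" "y \<in> S"
  shows "norm (f x - f y) \<le> B * \<bar>x - y\<bar>"
proof -
  have "norm (f x - f y) \<le> B * norm (x - y)"
  proof (rule differentiable_bound[OF assms(1) assms(2)[unfolded has_vector_derivative_def]])
    fix x assume "x \<in> S"
    from assms(3)[OF this] show "onorm (\<lambda>h. h *\<^sub>R f' x) \<le> B"
      by (intro onorm_le) (simp add: mult.commute[of B] mult_left_mono)
  qed (use assms in auto)
  then show ?thesis by simp
qed

lemma has_vector_derivative_imp_quotient_tendsto:
  assumes "(f has_vector_derivative D) (at x within S)"
  shows "((\<lambda>y. (f y - f x) /\<^sub>R (y - x)) \<longlongrightarrow> D) (at x within S)"
proof -
  have "((\<lambda>y. norm (f y - f x - (y - x) *\<^sub>R D) / norm (y - x)) \<longlongrightarrow> 0) (at x within S)"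
    using assms by (simp add: has_vector_derivative_def has_derivative_iff_norm)
  moreover have "eventually (\<lambda>y. norm (f y - f x - (y - x) *\<^sub>R D) / norm (y - x)
      = norm ((f y - f x) /\<^sub>R (y - x) - D)) (at x within S)"
    unfolding eventually_at_filter
  proof (intro always_eventually allI impI)
    fix y assume "y \<noteq> x"
    then have "(f y - f x) /\<^sub>R (y - x) - D = (f y - f x - (y - x) *\<^sub>R D) /\<^sub>R (y - x)"
      by (simp add: scaleR_diff_right)
    then show "norm (f y - f x - (y - x) *\<^sub>R D) / norm (y - x) = norm ((f y - f x) /\<^sub>R (y - x) - D)"
      by (simp add: divide_inverse mult.commute)
  qed
  ultimately have "((\<lambda>y. norm ((f y - f x) /\<^sub>R (y - x) - D)) \<longlongrightarrow> 0) (at x within S)"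
    by (rule Lim_transform_eventually)
  then show ?thesis by (subst Lim_null) (rule tendsto_norm_zero_cancel)
qed

text \<open>A single Fourier mode of the exact solution: a trajectory solving, for each velocity, the
  ordinary differential equation of which the scheme is the implicit Euler discretization. The
  time-independent envelope \<open>G\<close> replaces all uniform-in-time integrability statements.\<close>

locale mode_solution = equilibrium M for M :: "real ^ 'd \<Rightarrow> real" +
  fixes \<epsilon> T :: real and k :: "real ^ 'd" and g :: "real \<Rightarrow> real ^ 'd \<Rightarrow> complex" and G :: "real ^ 'd \<Rightarrow> real"
  assumes eps_pos: "0 < \<epsilon>"
    and g_int: "\<And>t. t \<in> {0..T} \<Longrightarrow> integrable lborel (g t)"
    and g_ode: "\<And>t v. t \<in> {0..T} \<Longrightarrow> ((\<lambda>s. g s v) has_vector_derivative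
        ((LINT w|lborel. g t w) * of_real (M v) - (1 + \<i> * of_real (\<epsilon> * (k \<bullet> v))) * g t v) / of_real (\<epsilon>\<^sup>2))
        (at t within {0..T})"
    and G_int: "integrable lborel G"
    and g_le: "\<And>t v. t \<in> {0..T} \<Longrightarrow> cmod (g t v) \<le> G v"
    and rho_le: "\<And>t v. t \<in> {0..T} \<Longrightarrow> cmod (LINT w|lborel. g t w) * M v \<le> G v"
begin

definition "rho t = (LINT w|lborel. g t w)"

definition rate :: "real \<Rightarrow> real ^ 'd \<Rightarrow> complex" where
  "rate t v = (rho t * of_real (M v) - (1 + \<i> * of_real (\<epsilon> * (k \<bullet> v))) * g t v) / of_real (\<epsilon>\<^sup>2)"

text \<open>The modulus of the symbol of the relaxation and transport operator, so that a time derivative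
  of \<open>g\<close> costs one factor \<open>K / \<epsilon>\<^sup>2\<close>.\<close>

definition K :: "real ^ 'd \<Rightarrow> real" where "K v = cmod (1 + \<i> * of_real (\<epsilon> * (k \<bullet> v)))"

lemma K_ge_1: "1 \<le> K v"
  unfolding K_def by (rule cmod_one_plus_imaginary_ge)

lemma relaxation_norm_le:
  "cmod (r * of_real (M v) - (1 + \<i> * of_real (\<epsilon> * (k \<bullet> v))) * z) \<le> cmod r * M v + K v * cmod z"
proof -
  have "cmod (r * of_real (M v) - (1 + \<i> * of_real (\<epsilon> * (k \<bullet> v))) * z)
      \<le> cmod (r * of_real (M v)) + cmod ((1 + \<i> * of_real (\<epsilon> * (k \<bullet> v))) * z)"
    by (rule norm_triangle_ineq4)
  also have "\<dots> = cmod r * M v + K v * cmod z"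
    unfolding norm_mult norm_of_real K_def using M_nonneg[of v] by simp
  finally show ?thesis .
qed

lemma K_sq: "(K v)\<^sup>2 = 1 + \<epsilon>\<^sup>2 * (k \<bullet> v)\<^sup>2"
  by (simp add: K_def cmod_power2 power_mult_distrib)

lemma K_measurable [measurable]: "K \<in> borel_measurable borel"
  unfolding K_def by measurable

lemma G_measurable [measurable]: "G \<in> borel_measurable borel"
  using borel_measurable_integrable[OF G_int] by simp

lemma deriv_g: "t \<in> {0..T} \<Longrightarrow> ((\<lambda>s. g s v) has_vector_derivative rate t v) (at t within {0..T})"
  unfolding rate_def rho_def by (rule g_ode)

lemma K_sq_ge: "K v \<le> (K v)\<^sup>2"
  using K_ge_1[of v] by (simp add: power2_eq_square)

text \<open>The gain and the loss term are both below \<open>K G\<close>, the gain because \<open>\<bar>\<rho>\<bar> M \<le> G\<close> and \<open>K \<ge> 1\<close>.\<close>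

lemma rate_bound:
  assumes t: "t \<in> {0..T}"
  shows "cmod (rate t v) \<le> 2 * K v * G v / \<epsilon>\<^sup>2"
proof -
  have "cmod (rho t * of_real (M v) - (1 + \<i> * of_real (\<epsilon> * (k \<bullet> v))) * g t v)
      \<le> cmod (rho t) * M v + K v * cmod (g t v)"
    by (rule relaxation_norm_le)
  also have "\<dots> \<le> 1 * G v + K v * G v"
    using rho_le[OF t, of v] g_le[OF t, of v] K_ge_1[of v]
    by (intro add_mono mult_left_mono) (auto simp: rho_def)
  also have "\<dots> \<le> K v * G v + K v * G v"
    using K_ge_1[of v] norm_ge_zero[THEN order_trans, OF g_le[OF t, of v]]
    by (intro add_mono mult_right_mono) auto
  also have "\<dots> = 2 * K v * G v" by simp
  finally have "cmod (rho t * of_real (M v) - (1 + \<i> * of_real (\<epsilon> * (k \<bullet> v))) * g t v) \<le> 2 * K v * G v" .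
  moreover have "cmod (of_real (\<epsilon>\<^sup>2)) = \<epsilon>\<^sup>2" unfolding norm_of_real by simp
  ultimately show ?thesis
    unfolding rate_def norm_divide by (metis divide_right_mono zero_le_power2)
qed

lemma g_Lipschitz:
  assumes "s \<in> {0..T}" "t \<in> {0..T}"
  shows "cmod (g s v - g t v) \<le> 2 * K v * G v / \<epsilon>\<^sup>2 * \<bar>s - t\<bar>"
  by (rule has_vector_derivative_bound[OF _ deriv_g rate_bound]) (use assms in auto)

lemma tail_bound:
  assumes W: "W \<in> sets borel"
  shows "integrable lborel (\<lambda>v. indicat_real (- W) v * G v)"
  using integrable_mult_indicator[OF _ G_int, of "- W"] W by simp

text \<open>A second-order residual costs two factors \<open>K\<close>, and \<open>K\<^sup>2 G\<close> need not be integrable for data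
  without velocity moments. Velocities are therefore split into a set \<open>W\<close> where it is integrable and
  a tail, which only enters through the mass of \<open>G\<close>. The choice \<open>W = UNIV\<close> is possible for data with
  second moments and gives the order; bounded sets \<open>W\<close> exhausting the space give convergence
  without a rate.\<close>

definition core_mass :: "(real ^ 'd) set \<Rightarrow> real" where
  "core_mass W = (LINT v|lborel. indicat_real W v * (K v)\<^sup>2 * G v)"

definition tail_mass :: "(real ^ 'd) set \<Rightarrow> real" where
  "tail_mass W = (LINT v|lborel. indicat_real (- W) v * G v)"

lemma G_nonneg: "t \<in> {0..T} \<Longrightarrow> 0 \<le> G v"
  using norm_ge_zero[THEN order_trans, OF g_le] .

lemma exact_step:
  assumes "0 < dt"
  shows "of_real (\<epsilon>\<^sup>2 + dt) * (1 + transport \<epsilon> dt k v) * g t' v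
    = of_real (\<epsilon>\<^sup>2) * g t v + of_real dt * rho t' * of_real (M v)
      + of_real (\<epsilon>\<^sup>2) * (g t' v - g t v - of_real dt * rate t' v)"
proof -
  have "of_real (\<epsilon>\<^sup>2) * rate t' v = rho t' * of_real (M v) - (1 + \<i> * of_real (\<epsilon> * (k \<bullet> v))) * g t' v"
    unfolding rate_def using eps_pos by simp
  then have "of_real (\<epsilon>\<^sup>2) * (of_real dt * rate t' v)
      = of_real dt * (rho t' * of_real (M v) - (1 + \<i> * of_real (\<epsilon> * (k \<bullet> v))) * g t' v)"
    by (metis mult.left_commute)
  then show ?thesis unfolding euler_coefficient[OF eps_pos assms] right_diff_distrib by (simp add:
      algebra_simps)
qed

context
  fixes W :: "(real ^ 'd) set"
  assumes W [measurable]: "W \<in> sets borel"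
    and J_int: "integrable lborel (\<lambda>v. indicat_real W v * (K v)\<^sup>2 * G v)"
begin


text \<open>The density feels all velocities. On the tail no Lipschitz bound in time is available, and the
  trivial bound \<open>2 G\<close> on the increment produces the term that does not vanish with \<open>\<bar>s - t\<bar>\<close>.\<close>

lemma rho_Lipschitz:
  assumes s: "s \<in> {0..T}" and t: "t \<in> {0..T}"
  shows "cmod (rho s - rho t) \<le> 2 * core_mass W / \<epsilon>\<^sup>2 * \<bar>s - t\<bar> + 2 * tail_mass W"
proof -
  let ?c = "2 / \<epsilon>\<^sup>2 * \<bar>s - t\<bar>"
  have "rho s - rho t = (LINT v|lborel. g s v - g t v)"
    unfolding rho_def using g_int s t by simp
  also have "cmod \<dots> \<le> (LINT v|lborel. cmod (g s v - g t v))" by simp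
  also have "\<dots> \<le> (LINT v|lborel. ?c * (indicat_real W v * (K v)\<^sup>2 * G v) + 2 * (indicat_real (- W) v
      * G v))"
  proof (rule integral_mono)
    show "integrable lborel (\<lambda>v. cmod (g s v - g t v))" using g_int s t by simp
    show "integrable lborel (\<lambda>v. ?c * (indicat_real W v * (K v)\<^sup>2 * G v) + 2 * (indicat_real (- W) v
        * G v))"
      using J_int tail_bound[OF W] by (intro Bochner_Integration.integrable_add integrable_mult_right)
    fix v
    show "cmod (g s v - g t v) \<le> ?c * (indicat_real W v * (K v)\<^sup>2 * G v) + 2 * (indicat_real (- W) v * G v)"
    proof (cases "v \<in> W")
      case True
      have "cmod (g s v - g t v) \<le> ?c * (K v * G v)"
        using g_Lipschitz[OF s t, of v] by (simp add: algebra_simps)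
      also have "\<dots> \<le> ?c * ((K v)\<^sup>2 * G v)"
        using K_sq_ge[of v] G_nonneg[OF s, of v] by (intro mult_left_mono mult_right_mono) auto
      finally show ?thesis using True by simp
    next
      case False
      then show ?thesis
        using norm_triangle_ineq4[of "g s v" "g t v"] g_le[OF s, of v] g_le[OF t, of v] by simp
    qed
  qed
  also have "\<dots> = ?c * core_mass W + 2 * tail_mass W"
    unfolding core_mass_def tail_mass_def using J_int tail_bound[OF W]
    by (subst Bochner_Integration.integral_add) (simp_all del: mult.assoc)
  finally show ?thesis by (simp add: algebra_simps)
qed

text \<open>The residual of the exact solution in the implicit Euler equation is at most \<open>dt\<close> times the
  oscillation of the rate over one step. The rate at time \<open>s\<close> depends on \<open>\<rho> s\<close> and \<open>g s\<close>, whose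
  increments are known.\<close>

lemma residual_bound:
  assumes t: "0 \<le> t" "0 < dt" "t + dt \<le> T"
  shows "\<epsilon>\<^sup>2 * cmod (g (t + dt) v - g t v - of_real dt * rate (t + dt) v)
    \<le> dt * ((2 * core_mass W / \<epsilon>\<^sup>2 * dt + 2 * tail_mass W) * M v + 2 * dt / \<epsilon>\<^sup>2 * ((K v)\<^sup>2 * G v))"
proof -
  let ?S = "{t..t + dt}" and ?t' = "t + dt"
  let ?B = "((2 * core_mass W / \<epsilon>\<^sup>2 * dt + 2 * tail_mass W) * M v + 2 * dt / \<epsilon>\<^sup>2 * ((K v)\<^sup>2 * G v)) / \<epsilon>\<^sup>2"
  have sub: "?S \<subseteq> {0..T}" using t by auto
  have t': "?t' \<in> {0..T}" using t by auto
  have "0 \<le> (LINT v|lborel. indicat_real W v * (K v)\<^sup>2 * G v)"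
    using G_nonneg[OF t'] by (intro integral_nonneg_AE) auto
  then have J0: "0 \<le> core_mass W" by (simp add: core_mass_def)
  have "norm (g ?t' v - g t v - (?t' - t) *\<^sub>R rate ?t' v) \<le> norm (?t' - t) * ?B"
  proof (rule vector_differentiable_bound_linearization[where S="?S"])
    fix s assume s: "s \<in> ?S"
    then have s': "s \<in> {0..T}" using sub by auto
    show "((\<lambda>s. g s v) has_vector_derivative rate s v) (at s within ?S)"
      using deriv_g[OF s'] sub by (rule has_vector_derivative_within_subset)
    have d: "\<bar>s - ?t'\<bar> \<le> dt" using s by auto
    have "(rate s v - rate ?t' v) = ((rho s - rho ?t') * of_real (M v)
        - (1 + \<i> * of_real (\<epsilon> * (k \<bullet> v))) * (g s v - g ?t' v)) / of_real (\<epsilon>\<^sup>2)"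
      unfolding rate_def diff_divide_distrib[symmetric] by (simp add: algebra_simps)
    also have "cmod \<dots> \<le> (cmod (rho s - rho ?t') * M v + K v * cmod (g s v - g ?t' v)) / \<epsilon>\<^sup>2"
    proof -
      have "cmod ((rho s - rho ?t') * of_real (M v) - (1 + \<i> * of_real (\<epsilon> * (k \<bullet> v))) * (g s v - g ?t' v))
        \<le> cmod (rho s - rho ?t') * M v + K v * cmod (g s v - g ?t' v)"
        by (rule relaxation_norm_le)
      then show ?thesis by (simp add: norm_divide norm_power divide_right_mono)
    qed
    also have "\<dots> \<le> ?B"
    proof (intro divide_right_mono add_mono)
      have "cmod (rho s - rho ?t') \<le> 2 * core_mass W / \<epsilon>\<^sup>2 * \<bar>s - ?t'\<bar> + 2 * tail_mass W"
        by (rule rho_Lipschitz[OF s' t'])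
      also have "\<dots> \<le> 2 * core_mass W / \<epsilon>\<^sup>2 * dt + 2 * tail_mass W"
        using d J0 by (intro add_right_mono mult_left_mono) auto
      finally show "cmod (rho s - rho ?t') * M v \<le> (2 * core_mass W / \<epsilon>\<^sup>2 * dt + 2 * tail_mass W) * M v"
        by (rule mult_right_mono[OF _ M_nonneg])
      have "K v * cmod (g s v - g ?t' v) \<le> K v * (2 * K v * G v / \<epsilon>\<^sup>2 * \<bar>s - ?t'\<bar>)"
        using K_ge_1[of v] by (intro mult_left_mono g_Lipschitz s' t') auto
      also have "\<dots> \<le> K v * (2 * K v * G v / \<epsilon>\<^sup>2 * dt)"
        using K_ge_1[of v] d G_nonneg[OF t', of v] by (intro mult_left_mono) auto
      also have "\<dots> = 2 * dt / \<epsilon>\<^sup>2 * ((K v)\<^sup>2 * G v)" by (simp add: power2_eq_square)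
      finally show "K v * cmod (g s v - g ?t' v) \<le> 2 * dt / \<epsilon>\<^sup>2 * ((K v)\<^sup>2 * G v)" .
    qed simp
    finally show "norm (rate s v - rate ?t' v) \<le> ?B" .
  qed (use t in \<open>auto simp: closed_segment_eq_real_ivl\<close>)
  then have "cmod (g ?t' v - g t v - of_real dt * rate ?t' v) \<le> dt * ?B"
    using t by (simp add: scaleR_conv_of_real)
  then have "\<epsilon>\<^sup>2 * cmod (g ?t' v - g t v - of_real dt * rate ?t' v) \<le> \<epsilon>\<^sup>2 * (dt * ?B)"
    by (rule mult_left_mono) simp
  also have "\<epsilon>\<^sup>2 * (dt * (x / \<epsilon>\<^sup>2)) = dt * x" for x
    using eps_pos by simp
  finally show ?thesis .
qed

text \<open>Error propagation, comparing the scheme with the truncated exact solution \<open>1\<^sub>W g\<close>. On \<open>W\<close> the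
  truncation satisfies the Euler equation up to the residual, off \<open>W\<close> it satisfies it up to the gain
  term \<open>\<rho> M\<close>, and the density of the truncation is off by the tail mass. All three defects enter the
  stability estimate as sources.\<close>

lemma step_error:
  assumes t: "0 \<le> t" "0 < dt" "t + dt \<le> T" and F: "integrable lborel F"
  shows "(LINT v|lborel. cmod (indicator W v *\<^sub>R g (t + dt) v - euler_step \<epsilon> dt k F v))
    \<le> (LINT v|lborel. cmod (indicator W v *\<^sub>R g t v - F v)) + 4 * tail_mass W / \<epsilon>\<^sup>2 * dt + 4 *
        core_mass W / \<epsilon> ^ 4 * dt\<^sup>2"
proof -
  let ?t' = "t + dt"
  have t': "?t' \<in> {0..T}" and t0: "t \<in> {0..T}" using t by auto
  let ?S = "euler_step \<epsilon> dt k F"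
  let ?E' = "\<lambda>v. indicator W v *\<^sub>R g ?t' v - ?S v" and ?E = "\<lambda>v. indicator W v *\<^sub>R g t v - F v"
  let ?q = "\<lambda>v. if v \<in> W then of_real (\<epsilon>\<^sup>2) * (g ?t' v - g t v - of_real dt * rate ?t' v)
    else - (of_real dt * rho ?t' * of_real (M v))"
  let ?a = "2 * core_mass W / \<epsilon>\<^sup>2 * dt + 2 * tail_mass W"
  let ?B = "\<lambda>v. dt * (?a * M v + 2 * dt / \<epsilon>\<^sup>2 * (indicat_real W v * (K v)\<^sup>2 * G v) + indicat_real (-
      W) v * G v)"
  \<comment> \<open>The error equation has the difference of the densities as its gain term on all of velocity space.\<close>
  let ?P = "rho ?t' - rho_update M \<epsilon> dt k F"
  have J0: "0 \<le> core_mass W" unfolding core_mass_def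
    using G_nonneg[OF t'] by (intro integral_nonneg_AE) auto
  have eta0: "0 \<le> tail_mass W" unfolding tail_mass_def
    using G_nonneg[OF t'] by (intro integral_nonneg_AE) auto
  have a0: "0 \<le> ?a" using J0 eta0 t by auto
  have S: "integrable lborel ?S" by (rule integrable_euler_step[OF F])
  have gW: "integrable lborel (\<lambda>v. indicator W v *\<^sub>R g s v)" if "s \<in> {0..T}" for s
    using g_int[OF that] W by (intro integrable_mult_indicator) auto
  have B: "integrable lborel ?B"
    using M_int J_int tail_bound[OF W]
    by (intro integrable_mult_right Bochner_Integration.integrable_add)
  have intB: "(LINT v|lborel. ?B v) = dt * (?a + 2 * dt / \<epsilon>\<^sup>2 * core_mass W + tail_mass W)"
  proof -
    have "(LINT v|lborel. ?B v) = dt * (?a * (LINT v|lborel. M v) + 2 * dt / \<epsilon>\<^sup>2 * core_mass W +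
        tail_mass W)"
      unfolding core_mass_def[symmetric] integral_mult_right_zero
      apply (subst Bochner_Integration.integral_add)
      apply (intro integrable_mult_right Bochner_Integration.integrable_add M_int J_int)
      apply (rule tail_bound[OF W])
      apply (subst Bochner_Integration.integral_add)
      apply (intro integrable_mult_right M_int)
      apply (intro integrable_mult_right J_int)
      by (simp only: integral_mult_right_zero core_mass_def tail_mass_def)
    then show ?thesis using M_mass by simp
  qed
  have "\<epsilon>\<^sup>2 * (LINT v|lborel. cmod (?E' v))
    \<le> \<epsilon>\<^sup>2 * (LINT v|lborel. cmod (?E v)) + dt * tail_mass W + (LINT v|lborel. ?B v)"
  proof (rule implicit_euler_estimate[OF eps_pos t(2) M_int M_nonneg M_mass _ _ B])
    show "integrable lborel ?E" "integrable lborel ?E'"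
      using gW[OF t0] gW[OF t'] F S by auto
    show "of_real (\<epsilon>\<^sup>2 + dt) * (1 + transport \<epsilon> dt k v) * ?E' v
        = of_real (\<epsilon>\<^sup>2) * ?E v + of_real dt * ?P * of_real (M v) + ?q v" for v
    proof (cases "v \<in> W")
      case True
      then show ?thesis
        using euler_step_eq[OF eps_pos t(2), of k v F] exact_step[OF t(2), of v ?t' t]
        by (simp add: algebra_simps)
    next
      case False
      then show ?thesis
        using euler_step_eq[OF eps_pos t(2), of k v F]
        by (simp add: algebra_simps)
    qed
    show "cmod (?q v) \<le> ?B v" for v
    proof (cases "v \<in> W")
      case True
      have "cmod (?q v) = \<epsilon>\<^sup>2 * cmod (g ?t' v - g t v - of_real dt * rate ?t' v)"
        using True by (simp add: norm_mult norm_power)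
      also note residual_bound[OF t]
      finally show ?thesis using True by simp
    next
      case False
      have "cmod (?q v) = dt * (cmod (rho ?t') * M v)"
        using False t M_nonneg[of v] by (simp add: norm_mult)
      also have "\<dots> \<le> dt * G v"
        using rho_le[OF t'] t by (intro mult_left_mono) (auto simp: rho_def)
      also have "\<dots> \<le> ?B v"
        using False t a0 M_nonneg[of v] by (intro mult_left_mono) auto
      finally show ?thesis .
    qed
    have "?P = (LINT v|lborel. g ?t' v - ?S v)"
      unfolding rho_def integral_euler_step[OF F eps_pos t(2), symmetric]
      using g_int[OF t'] S by simp
    also have "cmod \<dots> \<le> (LINT v|lborel. cmod (g ?t' v - ?S v))" by simp
    also have "\<dots> \<le> (LINT v|lborel. cmod (?E' v) + indicat_real (- W) v * G v)"
    proof (rule integral_mono)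
      show "integrable lborel (\<lambda>v. cmod (g ?t' v - ?S v))" using g_int[OF t'] S by simp
      show "integrable lborel (\<lambda>v. cmod (?E' v) + indicat_real (- W) v * G v)"
        using gW[OF t'] S tail_bound[OF W] by (intro Bochner_Integration.integrable_add
            integrable_norm Bochner_Integration.integrable_diff)
      show "cmod (g ?t' v - ?S v) \<le> cmod (?E' v) + indicat_real (- W) v * G v" for v
        using g_le[OF t', of v] norm_triangle_ineq4[of "g ?t' v" "?S v"]
        by (cases "v \<in> W") auto
    qed
    also have "\<dots> = (LINT v|lborel. cmod (?E' v)) + tail_mass W"
      unfolding tail_mass_def using gW[OF t'] S tail_bound[OF W]
      by (intro Bochner_Integration.integral_add integrable_norm Bochner_Integration.integrable_diff)
    finally show "cmod ?P \<le> (LINT v|lborel. cmod (?E' v)) + tail_mass W" .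
  qed
  also have "\<dots> = \<epsilon>\<^sup>2 * ((LINT v|lborel. cmod (?E v)) + 4 * tail_mass W / \<epsilon>\<^sup>2 * dt + 4 * core_mass W
      / \<epsilon> ^ 4 * dt\<^sup>2)"
  proof -
    have *: "e * x + dt * n + dt * (2 * j / e * dt + 2 * n + 2 * dt / e * j + n)
        = e * (x + 4 * n / e * dt + 4 * j / e\<^sup>2 * dt\<^sup>2)" if "e \<noteq> 0" for e x n j :: real
      using that by (simp add: divide_simps) (simp add: algebra_simps power2_eq_square)
    have e4: "\<epsilon> ^ 4 = (\<epsilon>\<^sup>2)\<^sup>2" by simp
    have "\<epsilon>\<^sup>2 \<noteq> 0" using eps_pos by simp
    then show ?thesis unfolding intB e4 by (rule *)
  qed
  finally show ?thesis
    by (rule mult_left_le_imp_le) (use eps_pos in simp)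
qed

text \<open>One step started from the exact solution: the error before the step is zero, and for
  \<open>W = UNIV\<close> there is no tail.\<close>

lemma local_error:
  assumes t: "0 \<le> t" "0 < dt" "t + dt \<le> T" and "W = UNIV"
  shows "(LINT v|lborel. cmod (euler_step \<epsilon> dt k (g t) v - g (t + dt) v)) \<le> 4 * core_mass W / \<epsilon> ^ 4 * dt\<^sup>2"
proof -
  have "tail_mass W = 0" unfolding \<open>W = UNIV\<close> tail_mass_def by simp
  moreover have "integrable lborel (g t)" using t by (intro g_int) auto
  ultimately show ?thesis
    using step_error[OF t, of "g t"] \<open>W = UNIV\<close> by (simp add: norm_minus_commute)
qed

lemma global_error_truncated:
  assumes dt: "0 < dt" and gg: "gg k = g 0" and n: "real n * dt \<le> T"
  shows "(LINT v|lborel. cmod (indicator W v *\<^sub>R g (real n * dt) v - scheme_f M \<epsilon> dt gg n k v))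
    \<le> tail_mass W + real n * (4 * tail_mass W / \<epsilon>\<^sup>2 * dt + 4 * core_mass W / \<epsilon> ^ 4 * dt\<^sup>2)"
  using n
proof (induction n)
  case 0
  then have 0: "0 \<in> {0..T}" by simp
  have "(LINT v|lborel. cmod (indicator W v *\<^sub>R g 0 v - g 0 v)) \<le> tail_mass W"
    unfolding tail_mass_def
  proof (rule integral_mono)
    show "integrable lborel (\<lambda>v. cmod (indicator W v *\<^sub>R g 0 v - g 0 v))"
      using g_int[OF 0] W by (intro integrable_norm Bochner_Integration.integrable_diff
          integrable_mult_indicator) auto
    show "cmod (indicator W v *\<^sub>R g 0 v - g 0 v) \<le> indicat_real (- W) v * G v" for v
      using g_le[OF 0, of v] by (cases "v \<in> W") auto
  qed (rule tail_bound[OF W])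
  then show ?case by (simp add: gg)
next
  case (Suc n)
  have e: "real (Suc n) * dt = real n * dt + dt" by (simp add: algebra_simps)
  have le: "0 \<le> real n * dt" "real n * dt + dt \<le> T" using Suc.prems dt unfolding e by auto
  have n: "real n * dt \<le> T" using le dt by simp
  have "0 \<in> {0..T}" using le n by auto
  then have f: "integrable lborel (scheme_f M \<epsilon> dt gg n k)"
    using g_int[of 0] by (intro integrable_scheme_f[where g=gg]) (simp add: gg)
  have step: "(LINT v|lborel. cmod (indicator W v *\<^sub>R g (real (Suc n) * dt) v - scheme_f M \<epsilon> dt gg
      (Suc n) k v))
    \<le> (LINT v|lborel. cmod (indicator W v *\<^sub>R g (real n * dt) v - scheme_f M \<epsilon> dt gg n k v))
      + 4 * tail_mass W / \<epsilon>\<^sup>2 * dt + 4 * core_mass W / \<epsilon> ^ 4 * dt\<^sup>2"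
    unfolding e scheme_f_Suc by (rule step_error[OF le(1) dt le(2) f])
  have "a \<le> c + (1 + real n) * (x + y)" if "a \<le> b + x + y" "b \<le> c + real n * (x + y)" for a b c x y
    using that by (simp add: algebra_simps)
  from this[OF step Suc.IH[OF n]] show ?case unfolding of_nat_Suc .
qed

text \<open>Contractivity lets the \<open>n\<close> local errors add up without amplification; there are at most
  \<open>T / dt\<close> of them. The constant \<open>2\<close> accounts for truncating at the initial and at the final time.\<close>

lemma global_error:
  assumes dt: "0 < dt" and gg: "gg k = g 0" and n: "real n * dt \<le> T"
  shows "(LINT v|lborel. cmod (scheme_f M \<epsilon> dt gg n k v - g (real n * dt) v))
    \<le> (2 + 4 * T / \<epsilon>\<^sup>2) * tail_mass W + 4 * T * core_mass W / \<epsilon> ^ 4 * dt"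
proof -
  let ?t = "real n * dt" and ?f = "scheme_f M \<epsilon> dt gg n k"
  have t: "?t \<in> {0..T}" using n dt by simp
  then have 0: "0 \<in> {0..T}" by auto
  have J0: "0 \<le> core_mass W" unfolding core_mass_def
    using G_nonneg[OF t] by (intro integral_nonneg_AE) auto
  have eta0: "0 \<le> tail_mass W" unfolding tail_mass_def
    using G_nonneg[OF t] by (intro integral_nonneg_AE) auto
  have f: "integrable lborel ?f"
    using g_int[OF 0] by (intro integrable_scheme_f[where g=gg]) (simp add: gg)
  let ?E = "\<lambda>v. indicator W v *\<^sub>R g ?t v - ?f v"
  have E: "integrable lborel ?E"
    using g_int[OF t] W f by (intro Bochner_Integration.integrable_diff integrable_mult_indicator) auto
  have "(LINT v|lborel. cmod (?f v - g ?t v)) \<le> (LINT v|lborel. cmod (?E v) + indicat_real (- W) v * G v)"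
  proof (rule integral_mono)
    show "integrable lborel (\<lambda>v. cmod (?f v - g ?t v))" using f g_int[OF t] by simp
    show "integrable lborel (\<lambda>v. cmod (?E v) + indicat_real (- W) v * G v)"
      using E tail_bound[OF W] by (intro Bochner_Integration.integrable_add integrable_norm)
    show "cmod (?f v - g ?t v) \<le> cmod (?E v) + indicat_real (- W) v * G v" for v
      using g_le[OF t, of v] norm_triangle_ineq4[of "?f v" "g ?t v"]
      by (cases "v \<in> W") (auto simp: norm_minus_commute)
  qed
  also have "\<dots> = (LINT v|lborel. cmod (?E v)) + tail_mass W"
    unfolding tail_mass_def using E tail_bound[OF W] by (intro Bochner_Integration.integral_add
        integrable_norm)
  finally have 1: "(LINT v|lborel. cmod (?f v - g ?t v)) \<le> (LINT v|lborel. cmod (?E v)) + tail_mass W" .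
  have 2: "(LINT v|lborel. cmod (?E v)) \<le> tail_mass W
      + real n * (4 * tail_mass W / \<epsilon>\<^sup>2 * dt + 4 * core_mass W / \<epsilon> ^ 4 * dt\<^sup>2)"
    by (rule global_error_truncated[where gg=gg, OF dt gg n])
  have "real n * (4 * tail_mass W / \<epsilon>\<^sup>2 * dt + 4 * core_mass W / \<epsilon> ^ 4 * dt\<^sup>2)
      = ?t * (4 * tail_mass W / \<epsilon>\<^sup>2 + 4 * core_mass W / \<epsilon> ^ 4 * dt)"
    by (simp add: algebra_simps power2_eq_square)
  also have "\<dots> \<le> T * (4 * tail_mass W / \<epsilon>\<^sup>2 + 4 * core_mass W / \<epsilon> ^ 4 * dt)"
    using n J0 eta0 dt by (intro mult_right_mono) auto
  finally have 3: "real n * (4 * tail_mass W / \<epsilon>\<^sup>2 * dt + 4 * core_mass W / \<epsilon> ^ 4 * dt\<^sup>2)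
      \<le> T * (4 * tail_mass W / \<epsilon>\<^sup>2 + 4 * core_mass W / \<epsilon> ^ 4 * dt)" .
  have "(2 + 4 * T / \<epsilon>\<^sup>2) * tail_mass W + 4 * T * core_mass W / \<epsilon> ^ 4 * dt
      = 2 * tail_mass W + T * (4 * tail_mass W / \<epsilon>\<^sup>2 + 4 * core_mass W / \<epsilon> ^ 4 * dt)"
    by (simp add: algebra_simps)
  with 1 2 3 show ?thesis by linarith
qed

end

lemma rho_update_tendsto:
  assumes F: "integrable lborel F"
  shows "((\<lambda>dt. rho_update M \<epsilon> dt k F) \<longlongrightarrow> (LINT v|lborel. F v)) (at_right 0)"
proof -
  have "((\<lambda>dt. dt / (\<epsilon>\<^sup>2 + dt)) \<longlongrightarrow> 0 / (\<epsilon>\<^sup>2 + 0)) (at_right 0)"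
    using eps_pos by (intro tendsto_intros) auto
  then have lam0: "((\<lambda>dt. lam \<epsilon> dt) \<longlongrightarrow> 0) (at_right 0)"
    by (simp add: lam_def[abs_def])
  then have c: "((\<lambda>dt. lam \<epsilon> dt * \<epsilon>) \<longlongrightarrow> 0) (at_right 0)"
    using tendsto_mult_left_zero by blast
  have lim: "((\<lambda>dt. LINT v|lborel. H v / (1 + transport \<epsilon> dt k v)) \<longlongrightarrow> (LINT v|lborel. H v)) (at_right 0)"
    if "integrable lborel H" for H
    using integral_resolvent_tendsto[OF that c, of k 1] by (simp add: transport_def mult.assoc)
  have A: "((\<lambda>dt. LINT v|lborel. of_real (M v) / (1 + transport \<epsilon> dt k v)) \<longlongrightarrow> 1) (at_right 0)"
    using lim[of "\<lambda>v. of_real (M v)"] M_int integral_M_complex by simp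
  have "((\<lambda>dt. rho_update M \<epsilon> dt k F) \<longlongrightarrow>
      (LINT v|lborel. F v) * inverse (1 + 1 / of_real (1 - 0) * (1 - 1))) (at_right 0)"
    unfolding rho_update_def transport_part_eq
    by (intro tendsto_intros lim A F lam0) auto
  then show ?thesis by simp
qed

text \<open>Pointwise in \<open>v\<close>, the difference quotient of the scheme is
  \<open>(P M - (1 + \<i> \<epsilon> k \<bullet> v) g) / (\<epsilon>\<^sup>2 + dt (1 + \<i> \<epsilon> k \<bullet> v))\<close>, which tends to the exact rate as soon as the
  updated density \<open>P\<close> tends to the density of \<open>g t\<close>.\<close>

lemma truncation_error:
  assumes t: "0 \<le> t" "t < T"
  shows "((\<lambda>dt. (g (t + dt) v - euler_step \<epsilon> dt k (g t) v) / of_real dt) \<longlongrightarrow> 0) (at_right 0)"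
proof -
  have tT: "t \<in> {0..T}" using t by simp
  let ?P = "\<lambda>dt. rho_update M \<epsilon> dt k (g t)"
  let ?a = "1 + \<i> * complex_of_real (\<epsilon> * (k \<bullet> v))"
  let ?S = "\<lambda>dt. euler_step \<epsilon> dt k (g t) v"
  have ev: "eventually (\<lambda>dt. 0 < dt \<and> dt < T - t) (at_right (0::real))"
    using t by (intro eventually_conj eventually_at_right_less eventually_at_right_real[THEN
        eventually_mono]) auto
  have "((\<lambda>s. (g s v - g t v) /\<^sub>R (s - t)) \<longlongrightarrow> rate t v) (at t within {0..T})"
    by (rule has_vector_derivative_imp_quotient_tendsto[OF deriv_g[OF tT]])
  then have "((\<lambda>dt. (g (t + dt) v - g t v) /\<^sub>R (t + dt - t)) \<longlongrightarrow> rate t v) (at_right 0)"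
  proof (rule filterlim_compose)
    show "filterlim (\<lambda>dt. t + dt) (at t within {0..T}) (at_right 0)"
      unfolding filterlim_at
      using t ev by (auto intro!: tendsto_eq_intros elim!: eventually_mono)
  qed
  then have 1: "((\<lambda>dt. (g (t + dt) v - g t v) / of_real dt) \<longlongrightarrow> rate t v) (at_right 0)"
    by (simp add: divide_inverse scaleR_conv_of_real mult.commute)
  have "((\<lambda>dt. (?P dt * of_real (M v) - ?a * g t v) / (of_real (\<epsilon>\<^sup>2) + of_real dt * ?a)) \<longlongrightarrow>
     (rho t * of_real (M v) - ?a * g t v) / (of_real (\<epsilon>\<^sup>2) + of_real 0 * ?a)) (at_right 0)"
    unfolding rho_def using eps_pos
    by (intro tendsto_intros rho_update_tendsto g_int tT) auto
  then have "((\<lambda>dt. (?P dt * of_real (M v) - ?a * g t v) / (of_real (\<epsilon>\<^sup>2) + of_real dt * ?a)) \<longlongrightarrow> rate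
      t v) (at_right 0)"
    by (simp add: rate_def)
  moreover have "eventually (\<lambda>dt. (?P dt * of_real (M v) - ?a * g t v) / (of_real (\<epsilon>\<^sup>2) + of_real dt * ?a)
      = (?S dt - g t v) / of_real dt) (at_right 0)"
    using ev
  proof eventually_elim
    case (elim dt)
    have tr: "complex_of_real (\<epsilon>\<^sup>2 + dt) * (1 + transport \<epsilon> dt k v) = of_real (\<epsilon>\<^sup>2) + of_real dt * ?a"
      using eps_pos elim by (simp add: euler_coefficient del: of_real_add)
    have ne: "\<epsilon>\<^sup>2 + dt \<noteq> 0" using elim eps_pos by (simp add: add_pos_pos less_imp_neq[symmetric])
    have D: "of_real (\<epsilon>\<^sup>2) + of_real dt * ?a \<noteq> 0"
      unfolding tr[symmetric] using ne by (simp del: of_real_add)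
    have "(of_real (\<epsilon>\<^sup>2) + of_real dt * ?a) * ?S dt
        = of_real (\<epsilon>\<^sup>2) * g t v + of_real dt * ?P dt * of_real (M v)"
      using euler_step_eq[OF eps_pos, of dt k v "g t"] elim unfolding tr by simp
    then have "of_real dt * (?P dt * of_real (M v) - ?a * g t v) = (?S dt - g t v) * (of_real (\<epsilon>\<^sup>2)
        + of_real dt * ?a)"
      by (simp add: algebra_simps)
    then show ?case using D elim by (subst frac_eq_eq) (auto simp: mult.commute)
  qed
  ultimately have 2: "((\<lambda>dt. (?S dt - g t v) / of_real dt) \<longlongrightarrow> rate t v) (at_right 0)"
    by (rule Lim_transform_eventually)
  from tendsto_diff[OF 1 2] show ?thesis
    by (simp add: diff_divide_distrib[symmetric])
qed

end

section \<open>Fourier modes of classical solutions\<close>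

lemma axis_add: "axis i (a + b) = axis i a + axis i (b :: real)"
  by (simp add: vec_eq_iff axis_def)

lemma axis_expansion: "a = (\<Sum>i\<in>UNIV. axis i (a $ i :: real))"
  by (simp add: vec_eq_iff axis_def sum.delta)

text \<open>Shifting the cell by \<open>s\<close> along an axis moves the slab \<open>x $ i \<le> s\<close> past the opposite face, where
  periodicity brings it back.\<close>

lemma integral_periodic_shift_axis_within:
  fixes h :: "real ^ 'd \<Rightarrow> complex"
  assumes cont: "continuous_on UNIV h" and per: "\<And>x. h (x + axis i (L $ i)) = h x"
    and s: "0 \<le> s" "s \<le> L $ i"
  shows "integral (cbox 0 L) (\<lambda>x. h (x + axis i s)) = integral (cbox 0 L) h"
proof -
  let ?l = "L $ i"
  have int: "h integrable_on cbox a b" for a b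
    by (intro integrable_continuous continuous_on_subset[OF cont]) auto
  have axis_nth': "axis i c $ j = (if j = i then c else 0)" for c :: real and j
    by (simp add: axis_def)
  have inner1: "x \<bullet> axis i 1 = x $ i" for x :: "real ^ 'd"
    by (simp add: inner_axis)
  note coords = Int_iff mem_Collect_eq mem_box_cart inner1 vector_add_component
    vector_minus_component axis_nth' zero_index
  have basis: "axis i 1 \<in> (Basis :: (real ^ 'd) set)" by simp
  have "integral (cbox 0 L) (\<lambda>x. h (x + axis i s)) = integral (cbox (axis i s) (L + axis i s)) h"
    using integral_shift_cbox[of "axis i s" "axis i s" "L + axis i s" h] by simp
  also have "\<dots> = integral (cbox (axis i s) (L + axis i s) \<inter> {x. x \<bullet> axis i 1 \<le> ?l}) h
      + integral (cbox (axis i s) (L + axis i s) \<inter> {x. ?l \<le> x \<bullet> axis i 1}) h"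
    by (rule integral_split[OF int basis])
  also have "cbox (axis i s) (L + axis i s) \<inter> {x. x \<bullet> axis i 1 \<le> ?l} = cbox (axis i s) L"
  proof -
    have "(\<forall>j. (if j = i then s else 0) \<le> x $ j \<and> x $ j \<le> L $ j + (if j = i then s else 0)) \<and> x $ i \<le> L $ i
        \<longleftrightarrow> (\<forall>j. (if j = i then s else 0) \<le> x $ j \<and> x $ j \<le> L $ j)" for x
      using s by (smt (verit))
    then show ?thesis unfolding set_eq_iff coords by blast
  qed
  also have "cbox (axis i s) (L + axis i s) \<inter> {x. ?l \<le> x \<bullet> axis i 1} = cbox (axis i ?l) (L + axis i s)"
  proof -
    have "(\<forall>j. (if j = i then s else 0) \<le> x $ j \<and> x $ j \<le> L $ j + (if j = i then s else 0)) \<and> L $ i \<le> x $ i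
        \<longleftrightarrow> (\<forall>j. (if j = i then L $ i else 0) \<le> x $ j \<and> x $ j \<le> L $ j + (if j = i then s else 0))" for x
      using s by (smt (verit))
    then show ?thesis unfolding set_eq_iff coords by blast
  qed
  also have "integral (cbox (axis i ?l) (L + axis i s)) h
      = integral (cbox 0 (L + axis i s - axis i ?l)) (\<lambda>x. h (x + axis i ?l))"
    using integral_shift_cbox[of "axis i ?l" "axis i ?l" "L + axis i s" h] by simp
  also have "\<dots> = integral (cbox 0 (L + axis i s - axis i ?l)) h"
    unfolding per ..
  also have "cbox 0 (L + axis i s - axis i ?l) = cbox 0 L \<inter> {x. x \<bullet> axis i 1 \<le> s}"
  proof -
    have "(\<forall>j. 0 \<le> x $ j \<and> x $ j \<le> L $ j + (if j = i then s else 0) - (if j = i then L $ i else 0))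
        \<longleftrightarrow> (\<forall>j. 0 \<le> x $ j \<and> x $ j \<le> L $ j) \<and> x $ i \<le> s" for x
      using s by (smt (verit))
    then show ?thesis unfolding set_eq_iff coords by blast
  qed
  also have "cbox (axis i s) L = cbox 0 L \<inter> {x. s \<le> x \<bullet> axis i 1}"
  proof -
    have "(\<forall>j. (if j = i then s else 0) \<le> x $ j \<and> x $ j \<le> L $ j)
        \<longleftrightarrow> (\<forall>j. 0 \<le> x $ j \<and> x $ j \<le> L $ j) \<and> s \<le> x $ i" for x
      using s by (smt (verit))
    then show ?thesis unfolding set_eq_iff coords by blast
  qed
  also have "integral (cbox 0 L \<inter> {x. s \<le> x \<bullet> axis i 1}) h + integral (cbox 0 L \<inter> {x. x \<bullet> axis i 1 \<le> s}) h
      = integral (cbox 0 L) h"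
    using integral_split[OF int basis, of 0 L s] by simp
  finally show ?thesis .
qed

lemma periodic_int_multiple:
  fixes h :: "real ^ 'd \<Rightarrow> complex" and m :: int
  assumes per: "\<And>x. h (x + axis i l) = h x"
  shows "h (x + axis i (of_int m * l)) = h x"
proof (induction m rule: int_induct[of _ 0])
  case base
  show ?case by (simp add: axis_def zero_vec_def[symmetric])
next
  case (step1 m)
  have "h (x + axis i (of_int (m + 1) * l)) = h (x + axis i (of_int m * l) + axis i l)"
    by (simp add: distrib_right axis_add add.assoc)
  with step1 per show ?case by simp
next
  case (step2 m)
  have "h (x + axis i (of_int (m - 1) * l)) = h (x + axis i (of_int (m - 1) * l) + axis i l)"
    by (simp only: per)
  also have "\<dots> = h (x + axis i (of_int m * l))"
    unfolding add.assoc axis_add[symmetric] by (simp add: algebra_simps)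
  finally show ?case using step2 by simp
qed

lemma integral_periodic_shift_axis:
  fixes h :: "real ^ 'd \<Rightarrow> complex"
  assumes cont: "continuous_on UNIV h" and per: "\<And>x. h (x + axis i (L $ i)) = h x"
    and l: "0 < L $ i"
  shows "integral (cbox 0 L) (\<lambda>x. h (x + axis i s)) = integral (cbox 0 L) h"
proof -
  let ?l = "L $ i"
  let ?r = "s - of_int \<lfloor>s / ?l\<rfloor> * ?l"
  have r: "0 \<le> ?r" "?r \<le> ?l"
    using l floor_divide_lower[OF l, of s] floor_divide_upper[OF l, of s] by (auto simp: algebra_simps)
  have "h (x + axis i s) = h (x + axis i ?r)" for x
  proof -
    have "h (x + axis i ?r) = h (x + axis i ?r + axis i (of_int \<lfloor>s / ?l\<rfloor> * ?l))"
      by (rule periodic_int_multiple[where h=h, OF per, symmetric])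
    then show ?thesis unfolding add.assoc axis_add[symmetric] by simp
  qed
  then show ?thesis
    using integral_periodic_shift_axis_within[OF cont per r] by simp
qed

text \<open>Translation invariance of the integral over a period cell stands in for integration by parts
  in \<open>x\<close>.\<close>

lemma integral_periodic_shift:
  fixes h :: "real ^ 'd \<Rightarrow> complex"
  assumes cont: "continuous_on UNIV h" and per: "\<And>i x. h (x + axis i (L $ i)) = h x"
    and L: "\<And>i. 0 < L $ i"
  shows "integral (cbox 0 L) (\<lambda>x. h (x + a)) = integral (cbox 0 L) h"
proof -
  have "integral (cbox 0 L) (\<lambda>x. h (x + (\<Sum>i\<in>S. axis i (a $ i)))) = integral (cbox 0 L) h" for S
    using finite[of S]
  proof (induction S rule: finite_induct)
    case (insert i S)
    let ?b = "\<Sum>i\<in>S. axis i (a $ i)"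
    have "integral (cbox 0 L) (\<lambda>x. h (x + axis i (a $ i) + ?b)) = integral (cbox 0 L) (\<lambda>x. h (x + ?b))"
    proof (rule integral_periodic_shift_axis[where h="\<lambda>x. h (x + ?b)"])
      show "continuous_on UNIV (\<lambda>x. h (x + ?b))"
        by (intro continuous_on_compose2[OF cont] continuous_intros) auto
      show "h (x + axis i (L $ i) + ?b) = h (x + ?b)" for x
        using per[of "x + ?b" i] by (simp add: add.assoc add.commute[of ?b])
    qed (rule L)
    with insert show ?case by (simp add: add.assoc)
  qed simp
  from this[of UNIV] show ?thesis
    by (simp add: axis_expansion[symmetric])
qed

definition character :: "real ^ 'd \<Rightarrow> real ^ 'd \<Rightarrow> complex" where
  "character k x = exp (- \<i> * of_real (k \<bullet> x))"

lemma character_eq_cis: "character k x = cis (- (k \<bullet> x))"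
  by (simp add: character_def cis_conv_exp)

lemma norm_character [simp]: "cmod (character k x) = 1"
  by (simp add: character_def)

lemma character_periodic:
  assumes "k \<in> dual_lattice L"
  shows "character k (x + axis i (L $ i)) = character k x"
proof -
  obtain m :: int where m: "k $ i * L $ i = 2 * pi * of_int m"
    using assms unfolding dual_lattice_def by blast
  have "- (k \<bullet> (x + axis i (L $ i))) = - (k \<bullet> x) + 2 * pi * of_int (- m)"
    by (simp add: inner_add_right inner_axis inner_real_def m)
  then have "character k (x + axis i (L $ i)) = cis (- (k \<bullet> x)) * cis (2 * pi * of_int (- m))"
    unfolding character_eq_cis cis_mult by (rule arg_cong)
  also have "cis (2 * pi * of_int (- m)) = 1"
    by (rule cis_multiple_2pi) (rule Ints_of_int)
  finally show ?thesis by (simp add: character_eq_cis)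
qed

lemma continuous_character [continuous_intros]:
  "continuous_on S f \<Longrightarrow> continuous_on S (\<lambda>y. character k (f y))"
  unfolding character_def by (intro continuous_intros)

lemma character_measurable [measurable]: "character k \<in> borel_measurable borel"
  unfolding character_def by measurable

lemma fourier_coeff_continuous:
  assumes "continuous_on UNIV \<phi>"
  shows "fourier_coeff L \<phi> k = integral (cbox 0 L) (\<lambda>x. character k x * of_real (\<phi> x)) / of_real
      (\<Prod>i\<in>UNIV. L $ i)"
proof -
  have "set_integrable lborel (cbox 0 L) (\<lambda>x. character k x * of_real (\<phi> x))"
    unfolding set_integrable_def
    by (intro borel_integrable_compact continuous_intros continuous_on_subset[OF assms]) auto
  from set_borel_integral_eq_integral(2)[OF this] show ?thesis
    by (simp add: fourier_coeff_def cell_def character_def)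
qed

text \<open>Fubini on the cell times velocity space: the Fourier coefficient and the velocity integral
  commute, so the density of the transform is the transform of the density.\<close>

lemma fourier_x_integrable:
  fixes g :: "real ^ 'd \<Rightarrow> real ^ 'd \<Rightarrow> real"
  assumes g: "set_integrable lborel (cell L \<times> UNIV) (\<lambda>(x, v). g x v)"
  shows "integrable lborel (fourier_x L g k)"
    and "(LINT v|lborel. fourier_x L g k v) = fourier_coeff L (density g) k"
proof -
  let ?V = "complex_of_real (\<Prod>i\<in>UNIV. L $ i)"
  let ?u = "\<lambda>x v. indicat_real (cell L) x *\<^sub>R (character k x * of_real (g x v))"
  define w where "w = (\<lambda>p. indicat_real (cell L \<times> UNIV) p *\<^sub>R (case p of (x, v) \<Rightarrow> g x v))"
  have w: "integrable (lborel \<Otimes>\<^sub>M lborel) w"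
    using g unfolding w_def set_integrable_def lborel_prod .
  have [measurable]: "w \<in> borel_measurable (borel \<Otimes>\<^sub>M borel)"
    using borel_measurable_integrable[OF w] by (simp cong: measurable_cong_sets)
  have u_eq: "case_prod ?u = (\<lambda>p. character k (fst p) * complex_of_real (w p))"
    by (auto simp: w_def fun_eq_iff indicator_def)
  have u: "integrable (lborel \<Otimes>\<^sub>M lborel) (case_prod ?u)"
    unfolding u_eq
  proof (rule Bochner_Integration.integrable_bound[OF w])
    show "(\<lambda>p. character k (fst p) * complex_of_real (w p)) \<in> borel_measurable (lborel \<Otimes>\<^sub>M lborel)"
      by (simp cong: measurable_cong_sets)
  qed (simp add: norm_mult)
  have fx: "fourier_x L g k = (\<lambda>v. (LINT x|lborel. ?u x v) / ?V)"
    by (simp add: fun_eq_iff fourier_x_def fourier_coeff_def set_lebesgue_integral_def character_def)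
  show "integrable lborel (fourier_x L g k)"
    unfolding fx using lborel_pair.integrable_snd[OF u] by simp
  have "(LINT v|lborel. fourier_x L g k v) = (LINT v|lborel. LINT x|lborel. ?u x v) / ?V"
    unfolding fx by simp
  also have "(LINT v|lborel. LINT x|lborel. ?u x v) = (LINT x|lborel. LINT v|lborel. ?u x v)"
    by (rule lborel_pair.Fubini_integral[OF u])
  also have "\<dots> / ?V = fourier_coeff L (density g) k"
    by (simp add: fourier_coeff_def density_def set_lebesgue_integral_def character_def)
  finally show "(LINT v|lborel. fourier_x L g k v) = fourier_coeff L (density g) k" .
qed

lemma fourier_x_second_moment:
  fixes g :: "real ^ 'd \<Rightarrow> real ^ 'd \<Rightarrow> real"
  assumes "finite_second_moment L g"
  shows "integrable lborel (\<lambda>v. (norm v)\<^sup>2 * cmod (fourier_x L g k v))"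
proof -
  have "fourier_x L (\<lambda>x v. (norm v)\<^sup>2 * g x v) k v = of_real ((norm v)\<^sup>2) * fourier_x L g k v" for v
  proof -
    have "(LINT x:cell L|lborel. E x * complex_of_real (c * g x v)) = of_real c * (LINT x:cell
        L|lborel. E x * of_real (g x v))"
      for E and c :: real
    proof -
      have "E x * complex_of_real (c * g x v) = of_real c * (E x * of_real (g x v))" for x
        by simp
      then show ?thesis by (simp only: set_integral_mult_right)
    qed
    then show ?thesis
      unfolding fourier_x_def fourier_coeff_def by (simp only: times_divide_eq_right)
  qed
  then have "(\<lambda>v. cmod (fourier_x L (\<lambda>x v. (norm v)\<^sup>2 * g x v) k v)) = (\<lambda>v. (norm v)\<^sup>2 * cmod
      (fourier_x L g k v))"
    by (simp add: fun_eq_iff norm_mult norm_power)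
  moreover have "integrable lborel (\<lambda>v. cmod (fourier_x L (\<lambda>x v. (norm v)\<^sup>2 * g x v) k v))"
    using assms unfolding finite_second_moment_def by (intro integrable_norm fourier_x_integrable(1))
  ultimately show ?thesis by simp
qed

locale kinetic_flow =
  fixes L :: "real ^ 'd" and M :: "real ^ 'd \<Rightarrow> real" and T \<epsilon> :: real and f0 f
  assumes L_pos: "\<And>i. 0 < L $ i" and M_pos: "\<And>v. 0 < M v" and eps: "0 < \<epsilon>"
    and sol: "kinetic_solution L M T \<epsilon> f0 f"
begin

lemma solution_derivative:
  obtains ft :: "real \<times> (real ^ 'd) \<Rightarrow> real" and fx :: "real \<times> (real ^ 'd) \<Rightarrow> real ^ 'd"
  where "continuous_on ({0..T} \<times> UNIV) ft"
    and "\<forall>t\<in>{0..T}. \<forall>x.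
          ((\<lambda>(s, y). f s y v) has_derivative (\<lambda>(s, y). ft (t, x) * s + fx (t, x) \<bullet> y))
            (at (t, x) within {0..T} \<times> UNIV) \<and>
          \<epsilon>\<^sup>2 * ft (t, x) + \<epsilon> * (v \<bullet> fx (t, x)) = density (f t) x * M v - f t x v"
  using sol[unfolded kinetic_solution_def, THEN conjunct2, THEN conjunct2, THEN spec, of v]
  by (elim exE conjE) (rule that)

lemma f_regular:
  assumes "t \<in> {0..T}"
  shows "x_periodic L (f t)" "set_integrable lborel (cell L \<times> UNIV) (\<lambda>(x, v). f t x v)"
proof -
  note reg = sol[unfolded kinetic_solution_def, THEN conjunct2, THEN conjunct1, THEN bspec, OF assms]
  show "x_periodic L (f t)" using reg by (rule conjunct1)
  show "set_integrable lborel (cell L \<times> UNIV) (\<lambda>(x, v). f t x v)"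
    by (rule reg[THEN conjunct2, THEN conjunct1])
qed

lemma f_periodic: "t \<in> {0..T} \<Longrightarrow> f t (x + axis i (L $ i)) v = f t x v"
  using f_regular(1)[unfolded x_periodic_def, THEN spec, THEN spec, THEN spec] .

lemma f_initial: "f 0 = f0"
  using sol[unfolded kinetic_solution_def, THEN conjunct1] .

lemma f_continuous: "continuous_on ({0..T} \<times> UNIV) (\<lambda>(s, y). f s y v)"
proof -
  obtain ft fx where F: "\<forall>t\<in>{0..T}. \<forall>x.
          ((\<lambda>(s, y). f s y v) has_derivative (\<lambda>(s, y). ft (t, x) * s + fx (t, x) \<bullet> y))
            (at (t, x) within {0..T} \<times> UNIV) \<and>
          \<epsilon>\<^sup>2 * ft (t, x) + \<epsilon> * (v \<bullet> fx (t, x)) = density (f t) x * M v - f t x v"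
    by (rule solution_derivative[of v])
  show ?thesis
    unfolding continuous_on_eq_continuous_within
  proof
    fix p :: "real \<times> (real ^ 'd)" assume "p \<in> {0..T} \<times> UNIV"
    then obtain t x where p: "p = (t, x)" "t \<in> {0..T}" by auto
    show "continuous (at p within {0..T} \<times> UNIV) (\<lambda>(s, y). f s y v)"
      unfolding p(1) by (rule has_derivative_continuous[OF F[THEN bspec, THEN spec, THEN conjunct1,
          OF p(2)]])
  qed
qed

text \<open>The density, an integral over velocities, is not obviously regular. But the equation expresses
  it, at any single velocity, through \<open>f\<close> and its derivatives; at \<open>v = 0\<close> the spatial derivative even
  drops out, and \<open>M 0 > 0\<close> allows division.\<close>

lemma density_continuous: "continuous_on ({0..T} \<times> UNIV) (\<lambda>(s, y). density (f s) y)"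
proof -
  obtain ft fx where c: "continuous_on ({0..T} \<times> UNIV) ft" and F: "\<forall>t\<in>{0..T}. \<forall>x.
          ((\<lambda>(s, y). f s y 0) has_derivative (\<lambda>(s, y). ft (t, x) * s + fx (t, x) \<bullet> y))
            (at (t, x) within {0..T} \<times> UNIV) \<and>
          \<epsilon>\<^sup>2 * ft (t, x) + \<epsilon> * (0 \<bullet> fx (t, x)) = density (f t) x * M 0 - f t x 0"
    by (rule solution_derivative[of 0])
  have eq: "\<epsilon>\<^sup>2 * ft (t, x) + \<epsilon> * (0 \<bullet> fx (t, x)) = density (f t) x * M 0 - f t x 0" if "t \<in> {0..T}" for t x
    by (rule F[THEN bspec, THEN spec, THEN conjunct2, OF that])
  have "continuous_on ({0..T} \<times> UNIV) (\<lambda>p. (\<epsilon>\<^sup>2 * ft p + (case p of (s, y) \<Rightarrow> f s y 0)) / M 0)"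
    using M_pos[of 0] by (intro continuous_intros c f_continuous) auto
  then show ?thesis
    by (rule continuous_on_eq) (use eq M_pos[of 0] in \<open>auto simp: field_simps\<close>)
qed

lemma density_periodic: "t \<in> {0..T} \<Longrightarrow> density (f t) (x + axis i (L $ i)) = density (f t) x"
  by (simp add: density_def f_periodic)

abbreviation "rho_hat k t \<equiv> fourier_coeff L (density (f t)) k"

lemma continuous_slice:
  assumes "continuous_on ({0..T} \<times> UNIV) (\<lambda>(s, y :: real ^ 'd). h s y)" "t \<in> {0..T}"
  shows "continuous_on UNIV (h t)"
proof -
  have "continuous_on UNIV ((\<lambda>(s, y). h s y) \<circ> Pair t)"
    using assms by (intro continuous_on_compose continuous_intros continuous_on_subset[OF assms(1)]) auto
  then show ?thesis by (simp add: o_def)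
qed

text \<open>By translation invariance the coefficient of \<open>f s\<close> may be computed along the characteristics
  \<open>x + s v / \<epsilon>\<close>. There the integrand has the time derivative prescribed by the right-hand side of the
  equation, plus the phase \<open>-\<i> k \<bullet> v / \<epsilon>\<close> of the moving character. Differentiating under the integral
  and translating back gives the equation of the mode, with no derivative left to integrate by
  parts.\<close>

lemma fourier_mode_ode:
  assumes k: "k \<in> dual_lattice L" and t: "t \<in> {0..T}"
  shows "((\<lambda>s. fourier_x L (f s) k v) has_vector_derivative
      (rho_hat k t * of_real (M v) - (1 + \<i> * of_real (\<epsilon> * (k \<bullet> v))) * fourier_x L (f t) k v) /
          of_real (\<epsilon>\<^sup>2))
      (at t within {0..T})"
proof -
  let ?w = "(1 / \<epsilon>) *\<^sub>R v"
  let ?V = "complex_of_real (\<Prod>i\<in>UNIV. L $ i)"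
  let ?\<Phi> = "\<lambda>s x. character k (x + s *\<^sub>R ?w) * complex_of_real (f s (x + s *\<^sub>R ?w) v)"
  let ?H = "\<lambda>s y. character k y * complex_of_real (density (f s) y) * of_real (M v / \<epsilon>\<^sup>2)
     - character k y * complex_of_real (f s y v) * ((1 + \<i> * of_real (\<epsilon> * (k \<bullet> v))) / of_real (\<epsilon>\<^sup>2))"
  obtain ft fx where F: "\<forall>t\<in>{0..T}. \<forall>x.
          ((\<lambda>(s, y). f s y v) has_derivative (\<lambda>(s, y). ft (t, x) * s + fx (t, x) \<bullet> y))
            (at (t, x) within {0..T} \<times> UNIV) \<and>
          \<epsilon>\<^sup>2 * ft (t, x) + \<epsilon> * (v \<bullet> fx (t, x)) = density (f t) x * M v - f t x v"
    by (rule solution_derivative[of v])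
  note der = F[THEN bspec, THEN spec, THEN conjunct1] and eq = F[THEN bspec, THEN spec, THEN conjunct2]
  have dPhi: "((\<lambda>s. ?\<Phi> s x) has_vector_derivative ?H s (x + s *\<^sub>R ?w)) (at s within {0..T})"
    if s: "s \<in> {0..T}" for s x
  proof -
    let ?y = "x + s *\<^sub>R ?w"
    let ?fd = "(density (f s) ?y * M v - f s ?y v) / \<epsilon>\<^sup>2"
    have ray: "((\<lambda>r. (r, x + r *\<^sub>R w)) has_derivative (\<lambda>h. (h, h *\<^sub>R w))) (at s within {0..T})" for
        w :: "real ^ 'd"
      by (auto intro!: derivative_eq_intros)
    have outer: "((\<lambda>(s, y). f s y v) has_derivative (\<lambda>(r, y). ft (s, ?y) * r + fx (s, ?y) \<bullet> y))
        (at (s, ?y) within (\<lambda>r. (r, x + r *\<^sub>R ?w)) ` {0..T})"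
      by (rule has_derivative_subset[OF der[OF s]]) auto
    have "((\<lambda>r. (\<lambda>(s, y). f s y v) (r, x + r *\<^sub>R ?w)) has_derivative
        (\<lambda>h. (\<lambda>(r, y). ft (s, ?y) * r + fx (s, ?y) \<bullet> y) (h, h *\<^sub>R ?w))) (at s within {0..T})"
      by (rule has_derivative_in_compose[OF ray outer])
    moreover have "(\<lambda>h. (\<lambda>(r, y). ft (s, ?y) * r + fx (s, ?y) \<bullet> y) (h, h *\<^sub>R ?w)) = (\<lambda>h. h *\<^sub>R ?fd)"
    proof
      fix h
      have gen: "a + (1 / e) * b = c / e\<^sup>2" if "e \<noteq> 0" "e\<^sup>2 * a + e * b = c" for a b c e :: real
        using that(1) unfolding that(2)[symmetric] by (simp add: add_divide_distrib power2_eq_square)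
      have "ft (s, ?y) + (1 / \<epsilon>) * (v \<bullet> fx (s, ?y)) = ?fd"
        by (rule gen[OF _ eq[OF s]]) (use eps in simp)
      then have "ft (s, ?y) + fx (s, ?y) \<bullet> ?w = ?fd"
        unfolding inner_scaleR_right inner_commute[of v] .
      then show "(\<lambda>(r, y). ft (s, ?y) * r + fx (s, ?y) \<bullet> y) (h, h *\<^sub>R ?w) = h *\<^sub>R ?fd"
        unfolding split_conv inner_scaleR_right[of _ h] real_scaleR_def mult.commute[of "ft (s, ?y)" h]
        by (simp only: distrib_left[symmetric])
    qed
    ultimately have "((\<lambda>r. f r (x + r *\<^sub>R ?w) v) has_vector_derivative ?fd) (at s within {0..T})"
      by (simp add: has_vector_derivative_def)
    then have f': "((\<lambda>r. complex_of_real (f r (x + r *\<^sub>R ?w) v)) has_vector_derivative of_real ?fd)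
        (at s within {0..T})"
      unfolding has_real_derivative_iff_has_vector_derivative[symmetric] by (rule
          has_vector_derivative_of_real)
    have "((\<lambda>r. - \<i> * complex_of_real (k \<bullet> (x + r *\<^sub>R w))) has_vector_derivative - \<i> * of_real (k \<bullet>
        w)) (at s within {0..T})" for w
      by (intro has_vector_derivative_mult_right has_vector_derivative_of_real)
         (auto simp: inner_add_right has_vector_derivative_def intro!: derivative_eq_intros)
    from field_vector_diff_chain_within[OF this[of ?w], of exp]
    have chi': "((\<lambda>r. character k (x + r *\<^sub>R ?w)) has_vector_derivative
        (- \<i> * of_real (k \<bullet> ?w)) * character k ?y) (at s within {0..T})"
      by (simp add: o_def character_def DERIV_exp has_field_derivative_at_within)
    show ?thesis
    proof (rule has_vector_derivative_eq_rhs[OF has_vector_derivative_mult[OF chi' f']])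
      have e2: "complex_of_real (k \<bullet> ?w) = of_real (\<epsilon> * (k \<bullet> v)) / of_real (\<epsilon>\<^sup>2)"
        using eps by (simp add: power2_eq_square)
      have "c * ((r * m - z) / e) + - \<i> * (a / e) * c * z = c * r * (m / e) - c * z * ((1 + \<i> * a) / e)"
        for c r m z e a :: complex
        by (simp add: diff_divide_distrib add_divide_distrib algebra_simps)
      then show "character k ?y * of_real ?fd + - \<i> * of_real (k \<bullet> ?w) * character k ?y * of_real (f
          s ?y v) = ?H s ?y"
        unfolding e2 of_real_divide of_real_diff of_real_mult[of "density (f s) ?y"] .
    qed
  qed
  have cF: "continuous_on ({0..T} \<times> UNIV) (\<lambda>(s, y). character k y * complex_of_real (f s y v))"
    using f_continuous[of v] by (auto simp: case_prod_beta intro!: continuous_intros)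
  have cD: "continuous_on ({0..T} \<times> UNIV) (\<lambda>(s, y). character k y * complex_of_real (density (f s) y))"
    using density_continuous by (auto simp: case_prod_beta intro!: continuous_intros)
  have cH: "continuous_on ({0..T} \<times> UNIV) (\<lambda>(s, y). ?H s y)"
    using continuous_on_diff[OF continuous_on_mult_right[OF cD, of "of_real (M v / \<epsilon>\<^sup>2)"]
      continuous_on_mult_right[OF cF, of "(1 + \<i> * of_real (\<epsilon> * (k \<bullet> v))) / of_real (\<epsilon>\<^sup>2)"]]
    by (simp add: case_prod_beta)
  have deriv_int: "((\<lambda>s. integral (cbox 0 L) (?\<Phi> s)) has_vector_derivative
      integral (cbox 0 L) (\<lambda>x. ?H t (x + t *\<^sub>R ?w))) (at t within {0..T})"
  proof (rule leibniz_rule_vector_derivative[where U="{0..T}"])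
    show "?\<Phi> s integrable_on cbox 0 L" if "s \<in> {0..T}" for s
    proof (rule integrable_continuous)
      have "continuous_on UNIV (\<lambda>y. character k y * complex_of_real (f s y v))"
        by (rule continuous_slice[OF cF that])
      then show "continuous_on (cbox 0 L) (?\<Phi> s)"
        by (rule continuous_on_compose2) (auto intro!: continuous_intros)
    qed
    show "continuous_on ({0..T} \<times> cbox 0 L) (\<lambda>(s, x). ?H s (x + s *\<^sub>R ?w))"
    proof -
      have ray: "continuous_on S (\<lambda>p :: real \<times> (real ^ 'd). (fst p, snd p + fst p *\<^sub>R w))" for S and
          w :: "real ^ 'd"
        by (intro continuous_intros)
      have "continuous_on ({0..T} \<times> cbox 0 L) (\<lambda>p. (\<lambda>(s, y). ?H s y) (fst p, snd p + fst p *\<^sub>R ?w))"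
        by (rule continuous_on_compose2[OF cH ray]) auto
      then show ?thesis by (simp add: case_prod_beta)
    qed
  qed (use t dPhi in auto)
  have Phi_int: "integral (cbox 0 L) (?\<Phi> s) = ?V * fourier_x L (f s) k v" if "s \<in> {0..T}" for s
  proof -
    have V: "?V \<noteq> 0" using L_pos by (simp add: less_imp_neq[symmetric])
    have "continuous_on UNIV (\<lambda>y. f s y v)"
      by (rule continuous_slice[OF f_continuous that])
    from fourier_coeff_continuous[OF this, of L k]
    have "?V * fourier_x L (f s) k v = integral (cbox 0 L) (\<lambda>y. character k y * complex_of_real (f s y v))"
      unfolding fourier_x_def using V by simp
    also have "\<dots> = integral (cbox 0 L) (?\<Phi> s)"
      using continuous_slice[OF cF that] character_periodic[OF k] f_periodic[OF that] L_pos
      by (intro integral_periodic_shift[symmetric, where h="\<lambda>y. character k y * complex_of_real (f s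
          y v)"]) simp_all
    finally show ?thesis by simp
  qed
  have H_int: "integral (cbox 0 L) (\<lambda>x. ?H t (x + t *\<^sub>R ?w))
     = ?V * ((rho_hat k t * of_real (M v) - (1 + \<i> * of_real (\<epsilon> * (k \<bullet> v))) * fourier_x L (f t) k v)
         / of_real (\<epsilon>\<^sup>2))"
  proof -
    have V: "?V \<noteq> 0" using L_pos by (simp add: less_imp_neq[symmetric])
    have int: "(\<lambda>y. character k y * complex_of_real (f t y v)) integrable_on cbox 0 L"
       "(\<lambda>y. character k y * complex_of_real (density (f t) y)) integrable_on cbox 0 L"
      using continuous_slice[OF cF t] continuous_slice[OF cD t]
      by (auto intro!: integrable_continuous intro: continuous_on_subset)
    have "integral (cbox 0 L) (\<lambda>x. ?H t (x + t *\<^sub>R ?w)) = integral (cbox 0 L) (?H t)"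
      using continuous_slice[OF cH t] character_periodic[OF k] f_periodic[OF t] density_periodic[OF t] L_pos
      by (intro integral_periodic_shift[where h="?H t"]) simp_all
    also have "\<dots> = integral (cbox 0 L) (\<lambda>y. character k y * complex_of_real (density (f t) y)) *
        of_real (M v / \<epsilon>\<^sup>2)
       - integral (cbox 0 L) (\<lambda>y. character k y * complex_of_real (f t y v)) * ((1 + \<i> * of_real (\<epsilon>
           * (k \<bullet> v))) / of_real (\<epsilon>\<^sup>2))"
      unfolding integral_mult_left[symmetric]
      by (intro Henstock_Kurzweil_Integration.integral_diff integrable_on_mult_left int)
    also have "integral (cbox 0 L) (\<lambda>y. character k y * complex_of_real (density (f t) y)) = ?V *
        rho_hat k t"
      using fourier_coeff_continuous[OF continuous_slice[OF density_continuous t], of L k] V by simp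
    also have "integral (cbox 0 L) (\<lambda>y. character k y * complex_of_real (f t y v)) = ?V * fourier_x
        L (f t) k v"
      unfolding fourier_x_def using fourier_coeff_continuous[OF continuous_slice[OF f_continuous t],
          of L v k] V by simp
    also have "a * r * of_real (M v / \<epsilon>\<^sup>2) - a * z * (c / of_real (\<epsilon>\<^sup>2)) = a * ((r * of_real (M v) -
        c * z) / of_real (\<epsilon>\<^sup>2))"
      for a r c z :: complex
      by (simp add: diff_divide_distrib algebra_simps)
    finally show ?thesis .
  qed
  have "((\<lambda>s. ?V * fourier_x L (f s) k v) has_vector_derivative
     ?V * ((rho_hat k t * of_real (M v) - (1 + \<i> * of_real (\<epsilon> * (k \<bullet> v))) * fourier_x L (f t) k v) /
         of_real (\<epsilon>\<^sup>2)))
     (at t within {0..T})"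
    by (rule has_vector_derivative_transform[OF t Phi_int[symmetric] deriv_int[unfolded H_int]])
  from has_vector_derivative_mult_right[OF this, of "inverse ?V"] show ?thesis
    using L_pos by (simp add: mult.assoc[symmetric] less_imp_neq[symmetric] del: of_real_prod)
qed

lemma rho_hat_bounded: "\<exists>R\<ge>0. \<forall>t\<in>{0..T}. cmod (rho_hat k t) \<le> R"
proof -
  have "compact ((\<lambda>(s, y). density (f s) y) ` ({0..T} \<times> cbox 0 L))"
    by (intro compact_continuous_image compact_Times continuous_on_subset[OF density_continuous]) auto
  then have "bounded ((\<lambda>(s, y). density (f s) y) ` ({0..T} \<times> cbox 0 L))"
    by (rule compact_imp_bounded)
  then obtain B where "\<forall>z\<in>(\<lambda>(s, y). density (f s) y) ` ({0..T} \<times> cbox 0 L). norm z \<le> B"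
    unfolding bounded_iff by blast
  then have B: "\<And>s y. s \<in> {0..T} \<Longrightarrow> y \<in> cbox 0 L \<Longrightarrow> \<bar>density (f s) y\<bar> \<le> B"
    by auto
  let ?R = "max B 0 * measure lborel (cbox 0 L) / \<bar>\<Prod>i\<in>UNIV. L $ i\<bar>"
  have "cmod (rho_hat k t) \<le> ?R" if t: "t \<in> {0..T}" for t
  proof -
    have c: "continuous_on UNIV (density (f t))" by (rule continuous_slice[OF density_continuous t])
    have "(\<lambda>x. character k x * complex_of_real (density (f t) x)) integrable_on cbox 0 L"
      by (intro integrable_continuous continuous_intros continuous_on_subset[OF c]) auto
    then have "cmod (integral (cbox 0 L) (\<lambda>x. character k x * complex_of_real (density (f t) x)))
        \<le> max B 0 * measure lborel (cbox 0 L)"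
      using B[OF t] by (intro has_integral_bound[OF _ integrable_integral]) (auto simp: norm_mult
          le_max_iff_disj)
    then show ?thesis
      unfolding fourier_coeff_continuous[OF c] norm_divide norm_of_real by (rule divide_right_mono) simp
  qed
  then show ?thesis by (intro exI[of _ ?R]) auto
qed

text \<open>Variation of constants: the mode is its initial value, damped by relaxation, plus the
  accumulated gain \<open>\<rho> M\<close>, and \<open>\<rho>\<close> is bounded because the density is continuous and periodic. Hence
  \<open>\<bar>g 0\<bar> + C M\<close> dominates the mode at all times, with the velocity moments that the datum shares with \<open>M\<close>.\<close>

lemma mode_envelope:
  assumes k: "k \<in> dual_lattice L"
  shows "\<exists>C\<ge>0. \<forall>t\<in>{0..T}. \<forall>v.
    cmod (fourier_x L (f t) k v) \<le> cmod (fourier_x L f0 k v) + C * M v \<and>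
    cmod (rho_hat k t) * M v \<le> cmod (fourier_x L f0 k v) + C * M v"
proof -
  obtain R where R: "0 \<le> R" "\<And>t. t \<in> {0..T} \<Longrightarrow> cmod (rho_hat k t) \<le> R"
    using rho_hat_bounded by blast
  let ?B = "exp (T / \<epsilon>\<^sup>2) * (R / \<epsilon>\<^sup>2)"
  have 1: "cmod (fourier_x L (f t) k v) \<le> cmod (fourier_x L f0 k v) + ?B * T * M v" if t: "t \<in>
      {0..T}" for t v
  proof -
    let ?a = "(1 + \<i> * of_real (\<epsilon> * (k \<bullet> v))) / of_real (\<epsilon>\<^sup>2)"
    \<comment> \<open>The integrating factor of the mode equation.\<close>
    let ?\<phi> = "\<lambda>s. exp (of_real s * ?a) * fourier_x L (f s) k v"
    have nexp: "cmod (exp (of_real s * ?a)) = exp (s / \<epsilon>\<^sup>2)" for s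
      by (simp add: Re_divide_of_real flip: of_real_power)
    have "norm (?\<phi> t - ?\<phi> 0) \<le> ?B * M v * \<bar>t - 0\<bar>"
    proof (rule has_vector_derivative_bound[where S="{0..T}"])
      fix s assume s: "s \<in> {0..T}"
      have "((\<lambda>s. complex_of_real s * ?a) has_vector_derivative ?a) (at s within {0..T})"
        by (rule has_vector_derivative_eq_rhs[OF has_vector_derivative_mult_left[OF
            has_vector_derivative_of_real[OF DERIV_ident]]]) simp
      from field_vector_diff_chain_within[OF this, of exp]
      have "((\<lambda>s. exp (of_real s * ?a)) has_vector_derivative ?a * exp (of_real s * ?a)) (at s
          within {0..T})"
        by (simp add: o_def DERIV_exp has_field_derivative_at_within)
      from has_vector_derivative_mult[OF this fourier_mode_ode[OF k s]]
      show "(?\<phi> has_vector_derivative exp (of_real s * ?a) * (rho_hat k s * of_real (M v) / of_real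
          (\<epsilon>\<^sup>2))) (at s within {0..T})"
      proof (rule has_vector_derivative_eq_rhs)
        have "e * ((r - b * z) / q) + b / q * e * z = e * (r / q)" for e r b z q :: complex
          by (simp add: diff_divide_distrib algebra_simps)
        then show "exp (of_real s * ?a) * ((rho_hat k s * of_real (M v)
            - (1 + \<i> * of_real (\<epsilon> * (k \<bullet> v))) * fourier_x L (f s) k v) / of_real (\<epsilon>\<^sup>2))
          + ?a * exp (of_real s * ?a) * fourier_x L (f s) k v
          = exp (of_real s * ?a) * (rho_hat k s * of_real (M v) / of_real (\<epsilon>\<^sup>2))" .
      qed
      have "cmod (exp (of_real s * ?a) * (rho_hat k s * of_real (M v) / of_real (\<epsilon>\<^sup>2)))
          = exp (s / \<epsilon>\<^sup>2) * (cmod (rho_hat k s) * M v / \<epsilon>\<^sup>2)"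
        unfolding norm_mult norm_divide norm_of_real nexp using M_pos[of v] by simp
      also have "\<dots> \<le> exp (T / \<epsilon>\<^sup>2) * (R * M v / \<epsilon>\<^sup>2)"
        using s R(2)[OF s] M_pos[of v] R(1)
        by (intro mult_mono divide_right_mono mult_right_mono) (auto simp: divide_right_mono less_imp_le)
      finally show "norm (exp (of_real s * ?a) * (rho_hat k s * of_real (M v) / of_real (\<epsilon>\<^sup>2))) \<le> ?B * M v"
        by simp
    qed (use t in auto)
    also have "\<dots> \<le> ?B * M v * T"
      using t R(1) M_pos[of v] by (intro mult_left_mono) (auto simp: less_imp_le)
    finally have "cmod (?\<phi> t) \<le> cmod (fourier_x L f0 k v) + ?B * T * M v"
      using norm_triangle_ineq2[of "?\<phi> t" "?\<phi> 0"] by (simp add: f_initial mult.commute mult.left_commute)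
    moreover have "1 * cmod (fourier_x L (f t) k v) \<le> exp (t / \<epsilon>\<^sup>2) * cmod (fourier_x L (f t) k v)"
      using t by (intro mult_right_mono) auto
    ultimately show ?thesis unfolding norm_mult nexp by simp
  qed
  show ?thesis
  proof (intro exI[of _ "?B * \<bar>T\<bar> + R"] conjI ballI allI)
    fix t v assume t: "t \<in> {0..T}"
    then have T: "\<bar>T\<bar> = T" by auto
    show "cmod (fourier_x L (f t) k v) \<le> cmod (fourier_x L f0 k v) + (?B * \<bar>T\<bar> + R) * M v"
      using 1[OF t, of v] R(1) M_pos[of v] unfolding T distrib_right
      by (smt (verit) mult_nonneg_nonneg)
    have "cmod (rho_hat k t) * M v \<le> R * M v"
      using R(2)[OF t] M_pos[of v] by (intro mult_right_mono) auto
    moreover have "0 \<le> ?B * \<bar>T\<bar> * M v" using R(1) M_pos[of v] by (simp add: less_imp_le)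
    ultimately show "cmod (rho_hat k t) * M v \<le> cmod (fourier_x L f0 k v) + (?B * \<bar>T\<bar> + R) * M v"
      unfolding distrib_right by (smt (verit) norm_ge_zero)
  qed (use R(1) in auto)
qed

end

section \<open>The diffusive limit of the scheme\<close>

context equilibrium
begin

lemma diffusion_coeff_nonneg: "0 \<le> diffusion_coeff M k"
  unfolding diffusion_coeff_def using M_nonneg by (intro integral_nonneg_AE) auto

context
  fixes k :: "real ^ 'd" and dt :: real
  assumes dt: "0 < dt"
begin

lemma lam_tendsto_1: "((\<lambda>\<epsilon>. lam \<epsilon> dt) \<longlongrightarrow> 1) (at_right 0)"
proof -
  have "((\<lambda>\<epsilon>. dt / (\<epsilon>\<^sup>2 + dt)) \<longlongrightarrow> dt / (0\<^sup>2 + dt)) (at_right 0)"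
    using dt by (intro tendsto_intros) auto
  then show ?thesis using dt by (simp add: lam_def[abs_def])
qed

lemma resolvent_tendsto_diffusive:
  fixes F :: "real ^ 'd \<Rightarrow> complex"
  assumes "integrable lborel F"
  shows "((\<lambda>\<epsilon>. LINT v|lborel. F v / (1 + transport \<epsilon> dt k v) ^ m) \<longlongrightarrow> (LINT v|lborel. F v)) (at_right 0)"
proof -
  have "((\<lambda>\<epsilon>. lam \<epsilon> dt * \<epsilon>) \<longlongrightarrow> 1 * 0) (at_right 0)"
    by (intro tendsto_intros lam_tendsto_1)
  from integral_resolvent_tendsto[OF assms this[simplified], of k m] show ?thesis
    by (simp add: transport_def)
qed

context
  assumes first_moment_int: "integrable lborel (\<lambda>v. (k \<bullet> v) * M v)"
    and first_moment: "(LINT v|lborel. (k \<bullet> v) * M v) = 0"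
    and second_moment_int: "integrable lborel (\<lambda>v. (k \<bullet> v)\<^sup>2 * M v)"
begin

text \<open>The factor \<open>1 / (1 - \<lambda>)\<close> blows up like \<open>dt / \<epsilon>\<^sup>2\<close>, so the integral of \<open>\<tau> M / (1 + \<tau>)\<close>, with
  \<open>\<tau>\<close> the transport symbol, must be expanded to second order. The split
  \<open>\<tau> / (1 + \<tau>) = \<tau> - \<tau>\<^sup>2 / (1 + \<tau>)\<close> isolates the first moment of \<open>M\<close>, which is zero, and the remaining
  \<open>\<tau>\<^sup>2\<close> exactly compensates \<open>1 / \<epsilon>\<^sup>2\<close>. This is where the diffusion coefficient arises.\<close>

lemma denom_eq:
  assumes \<epsilon>: "0 < \<epsilon>"
  shows "denom \<epsilon> dt k = (LINT v|lborel. of_real (M v) / (1 + transport \<epsilon> dt k v))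
    + of_real (dt\<^sup>2 / (\<epsilon>\<^sup>2 + dt)) * (LINT v|lborel. of_real ((k \<bullet> v)\<^sup>2 * M v) / (1 + transport \<epsilon> dt k v))"
proof -
  let ?c = "lam \<epsilon> dt * \<epsilon>"
  have tr: "transport \<epsilon> dt k v = \<i> * of_real (?c * (k \<bullet> v))" for v
    by (simp add: transport_def)
  have "transport \<epsilon> dt k v * of_real (M v) / (1 + transport \<epsilon> dt k v)
     = \<i> * of_real ?c * of_real ((k \<bullet> v) * M v)
       + of_real (?c\<^sup>2) * (of_real ((k \<bullet> v)\<^sup>2 * M v) / (1 + transport \<epsilon> dt k v))" for v
  proof -
    have "t * m / (1 + t) = t * m - t\<^sup>2 * (m / (1 + t))" if "1 + t \<noteq> 0" for t m :: complex
      using that by (simp add: field_simps power2_eq_square)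
    from this[OF one_plus_transport_nonzero] have "transport \<epsilon> dt k v * of_real (M v) / (1 +
        transport \<epsilon> dt k v)
      = transport \<epsilon> dt k v * of_real (M v) - (transport \<epsilon> dt k v)\<^sup>2 * (of_real (M v) / (1 +
          transport \<epsilon> dt k v))" .
    moreover have sq: "(transport \<epsilon> dt k v)\<^sup>2 = - of_real (?c\<^sup>2 * (k \<bullet> v)\<^sup>2)"
      unfolding tr by (simp add: power_mult_distrib)
    moreover have lin: "transport \<epsilon> dt k v * of_real (M v) = \<i> * of_real ?c * of_real ((k \<bullet> v) * M v)"
      unfolding tr by simp
    moreover have "a - (- of_real (x * y)) * (of_real z / t) = a + of_real x * (of_real (y * z) / t)"
      for a t :: complex and x y z :: real
      by simp
    ultimately show ?thesis by (simp only:)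
  qed
  moreover have "integrable lborel (\<lambda>v. of_real ((k \<bullet> v)\<^sup>2 * M v) / (1 + transport \<epsilon> dt k v))"
    using second_moment_int by (intro integrable_transport_resolvent integrable_of_real)
  moreover have "integrable lborel (\<lambda>v. complex_of_real ((k \<bullet> v) * M v))"
    using first_moment_int by (rule integrable_of_real)
  moreover have "(LINT v|lborel. complex_of_real ((k \<bullet> v) * M v)) = 0"
    using first_moment by (simp del: of_real_mult)
  ultimately have "(LINT v|lborel. transport \<epsilon> dt k v * of_real (M v) / (1 + transport \<epsilon> dt k v))
    = of_real (?c\<^sup>2) * (LINT v|lborel. of_real ((k \<bullet> v)\<^sup>2 * M v) / (1 + transport \<epsilon> dt k v))"
    by (simp add: Bochner_Integration.integral_add del: of_real_mult of_real_power
        times_divide_eq_right times_divide_eq_left)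
  moreover have "1 / complex_of_real (1 - lam \<epsilon> dt) * of_real (?c\<^sup>2) = of_real (dt\<^sup>2 / (\<epsilon>\<^sup>2 + dt))"
  proof -
    have ne: "\<epsilon>\<^sup>2 + dt \<noteq> 0" "\<epsilon>\<^sup>2 \<noteq> 0" using \<epsilon> dt by (auto simp: add_pos_pos less_imp_neq[symmetric])
    have "1 / (e / s) * ((d / s)\<^sup>2 * e) = d\<^sup>2 / s" if "s \<noteq> 0" "e \<noteq> 0" for s e d :: real
      using that by (simp add: power2_eq_square)
    from this[OF ne] have "1 / (1 - lam \<epsilon> dt) * ?c\<^sup>2 = dt\<^sup>2 / (\<epsilon>\<^sup>2 + dt)"
      unfolding lam_compl[OF \<epsilon> dt] power_mult_distrib unfolding lam_def .
    then have "complex_of_real (1 / (1 - lam \<epsilon> dt)) * of_real (?c\<^sup>2) = of_real (dt\<^sup>2 / (\<epsilon>\<^sup>2 + dt))"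
      unfolding of_real_mult[symmetric] by (rule arg_cong)
    then show ?thesis unfolding of_real_divide[of 1] of_real_1 .
  qed
  ultimately show ?thesis by (simp only: mult.assoc[symmetric])
qed

lemma denom_tendsto:
  "((\<lambda>\<epsilon>. denom \<epsilon> dt k) \<longlongrightarrow> of_real (1 + dt * diffusion_coeff M k)) (at_right 0)"
proof -
  have A: "((\<lambda>\<epsilon>. LINT v|lborel. of_real (M v) / (1 + transport \<epsilon> dt k v)) \<longlongrightarrow> 1) (at_right 0)"
    using resolvent_tendsto_diffusive[of "\<lambda>v. of_real (M v)" 1] M_int integral_M_complex by simp
  have B: "((\<lambda>\<epsilon>. LINT v|lborel. of_real ((k \<bullet> v)\<^sup>2 * M v) / (1 + transport \<epsilon> dt k v))
      \<longlongrightarrow> of_real (diffusion_coeff M k)) (at_right 0)"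
    using resolvent_tendsto_diffusive[OF integrable_of_real[OF second_moment_int], of 1]
    unfolding diffusion_coeff_def integral_complex_of_real[symmetric] by simp
  have lim: "((\<lambda>\<epsilon>. (LINT v|lborel. of_real (M v) / (1 + transport \<epsilon> dt k v)) + of_real (dt\<^sup>2 / (\<epsilon>\<^sup>2 + dt)) *
      (LINT v|lborel. of_real ((k \<bullet> v)\<^sup>2 * M v) / (1 + transport \<epsilon> dt k v)))
    \<longlongrightarrow> 1 + of_real (dt\<^sup>2 / (0\<^sup>2 + dt)) * of_real (diffusion_coeff M k)) (at_right 0)"
    using dt by (intro tendsto_intros A B) auto
  have "dt\<^sup>2 / (0\<^sup>2 + dt) = dt" using dt by (simp add: power2_eq_square)
  then have lim_eq: "1 + of_real (dt\<^sup>2 / (0\<^sup>2 + dt)) * of_real (diffusion_coeff M k)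
      = complex_of_real (1 + dt * diffusion_coeff M k)" by simp
  show ?thesis
    by (rule Lim_transform_eventually[OF lim[unfolded lim_eq] eventually_mono[OF eventually_at_right_less]])
       (rule denom_eq[symmetric])
qed

text \<open>The next density is the mean of \<open>f\<^sup>n / (1 + \<tau>)\<close> over the denominator, hence both the mean and
  the density are carried through the induction. After a step the memory \<open>(1 - \<lambda>) f\<^sup>n\<close> disappears in
  the limit, since \<open>f\<^sup>n\<close> stays bounded in \<open>L\<^sup>1\<close> by contractivity; what remains is the local equilibrium
  \<open>\<rho> M\<close>. So even data far from equilibrium follow implicit Euler for the diffusion equation from the
  first step on.\<close>

lemma scheme_diffusive_limit:
  fixes g :: "real ^ 'd \<Rightarrow> real ^ 'd \<Rightarrow> complex"
  assumes g: "integrable lborel (g k)"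
  defines "r \<equiv> \<lambda>n. (LINT v|lborel. g k v) / of_real (1 + dt * diffusion_coeff M k) ^ n"
  shows "((\<lambda>\<epsilon>. LINT v|lborel. scheme_f M \<epsilon> dt g n k v / (1 + transport \<epsilon> dt k v)) \<longlongrightarrow> r n) (at_right 0)
    \<and> ((\<lambda>\<epsilon>. scheme_rho M \<epsilon> dt g n k) \<longlongrightarrow> r n) (at_right 0)"
proof (induction n)
  case 0
  show ?case using resolvent_tendsto_diffusive[OF g, of 1] by (simp add: r_def)
next
  case (Suc n)
  let ?d = "complex_of_real (1 + dt * diffusion_coeff M k)"
  let ?f = "\<lambda>\<epsilon>. scheme_f M \<epsilon> dt g n k"
  have f: "integrable lborel (?f \<epsilon>)" for \<epsilon>
    by (rule integrable_scheme_f[where g=g, OF g])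
  have d: "?d \<noteq> 0"
    using dt diffusion_coeff_nonneg by (metis add_pos_nonneg mult_nonneg_nonneg less_imp_le
        less_irrefl of_real_eq_0_iff zero_less_one)
  have "((\<lambda>\<epsilon>. rho_update M \<epsilon> dt k (?f \<epsilon>)) \<longlongrightarrow> r n * inverse ?d) (at_right 0)"
    unfolding rho_update_def using Suc.IH
    by (intro tendsto_mult tendsto_inverse denom_tendsto d) auto
  then have rho: "((\<lambda>\<epsilon>. rho_update M \<epsilon> dt k (?f \<epsilon>)) \<longlongrightarrow> r (Suc n)) (at_right 0)"
    by (simp add: r_def divide_inverse mult.commute mult.left_commute)
  have split: "(LINT v|lborel. euler_step \<epsilon> dt k (?f \<epsilon>) v / (1 + transport \<epsilon> dt k v))
      = of_real (1 - lam \<epsilon> dt) * (LINT v|lborel. ?f \<epsilon> v / (1 + transport \<epsilon> dt k v) ^ 2)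
        + of_real (lam \<epsilon> dt) * rho_update M \<epsilon> dt k (?f \<epsilon>) * (LINT v|lborel. of_real (M v) / (1 +
            transport \<epsilon> dt k v) ^ 2)" for \<epsilon>
  proof -
    have "1 / t * (a * x + b * c * y) / t = a * (x / t ^ 2) + b * c * (y / t ^ 2)" for t a b c x y
        :: complex
      by (simp add: add_divide_distrib power2_eq_square)
    then have "euler_step \<epsilon> dt k (?f \<epsilon>) v / (1 + transport \<epsilon> dt k v)
      = of_real (1 - lam \<epsilon> dt) * (?f \<epsilon> v / (1 + transport \<epsilon> dt k v) ^ 2)
        + of_real (lam \<epsilon> dt) * rho_update M \<epsilon> dt k (?f \<epsilon>) * (of_real (M v) / (1 + transport \<epsilon> dt k
            v) ^ 2)" for v
      unfolding euler_step_def .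
    moreover have "integrable lborel (\<lambda>v. H v / (1 + transport \<epsilon> dt k v) ^ 2)" if "integrable lborel
        H" for H
      using integrable_resolvent[OF that, of "lam \<epsilon> dt * \<epsilon>" k 2] by (simp add: transport_def)
    ultimately show ?thesis
      using f M_int
      by (simp add: Bochner_Integration.integral_add del: times_divide_eq_right times_divide_eq_left
          of_real_diff)
  qed
  have "((\<lambda>\<epsilon>. of_real (1 - lam \<epsilon> dt) * (LINT v|lborel. ?f \<epsilon> v / (1 + transport \<epsilon> dt k v) ^ 2)) \<longlongrightarrow> 0)
      (at_right 0)"
  proof (rule Lim_null_comparison)
    let ?C = "LINT v|lborel. cmod (g k v)"
    have "((\<lambda>\<epsilon>. \<bar>1 - lam \<epsilon> dt\<bar> * ?C) \<longlongrightarrow> \<bar>1 - 1\<bar> * ?C) (at_right 0)"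
      by (intro tendsto_intros lam_tendsto_1)
    then show "((\<lambda>\<epsilon>. \<bar>1 - lam \<epsilon> dt\<bar> * ?C) \<longlongrightarrow> 0) (at_right 0)" by simp
    show "\<forall>\<^sub>F \<epsilon> in at_right 0. norm (of_real (1 - lam \<epsilon> dt) * (LINT v|lborel. ?f \<epsilon> v / (1 +
        transport \<epsilon> dt k v) ^ 2))
      \<le> \<bar>1 - lam \<epsilon> dt\<bar> * ?C"
      using eventually_at_right_less[of 0]
    proof eventually_elim
      case (elim \<epsilon>)
      have i: "integrable lborel (\<lambda>v. ?f \<epsilon> v / (1 + transport \<epsilon> dt k v) ^ 2)"
        using integrable_resolvent[OF f, of \<epsilon> "lam \<epsilon> dt * \<epsilon>" k 2] by (simp add: transport_def)
      have "cmod (LINT v|lborel. ?f \<epsilon> v / (1 + transport \<epsilon> dt k v) ^ 2)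
          \<le> (LINT v|lborel. cmod (?f \<epsilon> v / (1 + transport \<epsilon> dt k v) ^ 2))" by simp
      also have "\<dots> \<le> (LINT v|lborel. cmod (?f \<epsilon> v))"
      proof (rule integral_mono)
        show "cmod (?f \<epsilon> v / (1 + transport \<epsilon> dt k v) ^ 2) \<le> cmod (?f \<epsilon> v)" for v
          unfolding transport_def by (rule cmod_divide_one_plus_imaginary_le)
      qed (use i f in auto)
      also have "\<dots> \<le> ?C" by (rule scheme_f_bounded[where g=g, OF g elim dt])
      finally have le: "cmod (LINT v|lborel. ?f \<epsilon> v / (1 + transport \<epsilon> dt k v) ^ 2) \<le> ?C" .
      show ?case unfolding norm_mult norm_of_real by (intro mult_left_mono le) simp
    qed
  qed
  moreover have "((\<lambda>\<epsilon>. of_real (lam \<epsilon> dt) * rho_update M \<epsilon> dt k (?f \<epsilon>) * (LINT v|lborel. of_real (M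
      v) / (1 + transport \<epsilon> dt k v) ^ 2))
      \<longlongrightarrow> of_real 1 * r (Suc n) * (LINT v|lborel. complex_of_real (M v))) (at_right 0)"
    using M_int by (intro tendsto_mult tendsto_of_real lam_tendsto_1 rho resolvent_tendsto_diffusive
        integrable_of_real)
  ultimately have "((\<lambda>\<epsilon>. LINT v|lborel. euler_step \<epsilon> dt k (?f \<epsilon>) v / (1 + transport \<epsilon> dt k v))
      \<longlongrightarrow> 0 + of_real 1 * r (Suc n) * (LINT v|lborel. complex_of_real (M v))) (at_right 0)"
    unfolding split by (rule tendsto_add)
  then show ?case using rho unfolding scheme_f_Suc integral_M_complex scheme_rho.simps by simp
qed

end
end
end


section \<open>The diffusion equation and its implicit Euler discretization\<close>

lemma diffusion_solution_eq:
  assumes u: "diffusion_solution M T k u0 u" and t: "t \<in> {0..T}"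
  shows "u t = u0 * of_real (exp (- diffusion_coeff M k * t))"
proof -
  let ?D = "diffusion_coeff M k"
  have "norm (of_real (exp (?D * t)) * u t - of_real (exp (?D * 0)) * u 0) \<le> 0 * \<bar>t - 0\<bar>"
  proof (rule has_vector_derivative_bound[where S="{0..T}"])
    fix s assume "s \<in> {0..T}"
    then have du: "(u has_vector_derivative - of_real ?D * u s) (at s within {0..T})"
      using u by (simp add: diffusion_solution_def)
    have de: "((\<lambda>s. complex_of_real (exp (?D * s))) has_vector_derivative of_real (?D * exp (?D *
        s))) (at s within {0..T})"
      by (rule has_vector_derivative_of_real)
         (auto intro!: derivative_eq_intros simp: has_real_derivative_iff_has_vector_derivative[symmetric])
    from has_vector_derivative_mult[OF de du]
    show "((\<lambda>s. of_real (exp (?D * s)) * u s) has_vector_derivative 0) (at s within {0..T})"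
      by (simp add: algebra_simps)
  qed (use t in auto)
  then have "of_real (exp (?D * t)) * u t = u0"
    using u by (simp add: diffusion_solution_def)
  then have "of_real (exp (- ?D * t)) * (of_real (exp (?D * t)) * u t) = u0 * of_real (exp (- ?D * t))"
    by (simp add: mult.commute)
  then show ?thesis
    by (simp add: mult.assoc[symmetric] exp_minus flip: of_real_mult)
qed

text \<open>Both \<open>1 / (1 + x)\<close> and \<open>exp (-x)\<close> lie between \<open>1 - x\<close> and \<open>1 - x + x\<^sup>2\<close> and in the unit interval,
  and \<open>n\<close>-th powers of such numbers differ by at most \<open>n\<close> times as much.\<close>

lemma implicit_euler_exp_error:
  fixes x :: real
  assumes "0 \<le> x"
  shows "\<bar>1 / (1 + x) ^ n - exp (- (real n * x))\<bar> \<le> real n * x\<^sup>2"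
proof -
  have e: "1 - x \<le> exp (- x)" using exp_ge_add_one_self[of "- x"] by simp
  have "exp (- x) \<le> 1 / (1 + x)"
    using exp_ge_add_one_self[of x] assms by (simp add: exp_minus field_simps)
  moreover have "1 / (1 + x) \<le> 1 - x + x\<^sup>2"
  proof -
    have "(1 - x + x\<^sup>2) * (1 + x) = 1 + x * x\<^sup>2" by (simp add: algebra_simps power2_eq_square)
    then show ?thesis using assms by (subst pos_divide_le_eq) auto
  qed
  ultimately have "norm (1 / (1 + x) - exp (- x)) \<le> x\<^sup>2" using e by simp
  moreover have "norm ((1 / (1 + x)) ^ n - exp (- x) ^ n) \<le> real n * norm (1 / (1 + x) - exp (- x))"
    using assms by (intro norm_power_diff) auto
  ultimately have "norm ((1 / (1 + x)) ^ n - exp (- x) ^ n) \<le> real n * x\<^sup>2"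
    by (meson mult_left_mono of_nat_0_le_iff order_trans)
  then show ?thesis
    by (simp add: power_one_over exp_of_nat_mult[symmetric])
qed

section \<open>Order, consistency and the asymptotic preserving property\<close>

lemma L1_dist_eq:
  assumes "integrable lborel g" "integrable lborel h"
  shows "L1_dist g h = ennreal (LINT v|lborel. cmod (g v - h v))"
  unfolding L1_dist_def using assms by (intro nn_integral_eq_integral) auto

lemma grid_time_le:
  fixes T :: real
  assumes "0 < T" "1 \<le> N" "n \<le> N"
  shows "real n * (T / real N) \<le> T"
proof -
  have "real n * (T / real N) \<le> real N * (T / real N)"
    using assms by (intro mult_right_mono) auto
  then show ?thesis using assms by simp
qed

text \<open>A mode of an exact solution together with the envelope constructed above.\<close>

locale kinetic_mode = kinetic_flow L M T \<epsilon> f0 f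
    + mode_solution M \<epsilon> T k "\<lambda>t. fourier_x L (f t) k" "\<lambda>v. cmod (fourier_x L f0 k v) + C * M v"
  for L :: "real ^ 'd" and M T \<epsilon> f0 f k C +
  assumes T_pos: "0 < T" and C_nonneg: "0 \<le> C"
begin

lemma f0_int: "integrable lborel (fourier_x L f0 k)"
  using g_int[of 0] T_pos unfolding f_initial by simp

text \<open>The densities differ by at most the \<open>L\<^sup>1\<close> distance of the distributions, since both are velocity
  integrals; a single bound therefore controls \<open>f\<close> and \<open>\<rho>\<close>.\<close>

lemma discrete_errors:
  assumes W: "W \<in> sets borel"
    and J_int: "integrable lborel (\<lambda>v. indicat_real W v * (K v)\<^sup>2 * (cmod (fourier_x L f0 k v) + C * M v))"
    and N: "1 \<le> N" and n: "n \<le> N"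
    and B: "(2 + 4 * T / \<epsilon>\<^sup>2) * tail_mass W + 4 * T * core_mass W / \<epsilon> ^ 4 * (T / real N) \<le> B"
  shows "let dt = T / real N; t = real n * dt in
         L1_dist (scheme_f M \<epsilon> dt (fourier_x L f0) n k) (fourier_x L (f t) k) \<le> ennreal B \<and>
         cmod (scheme_rho M \<epsilon> dt (fourier_x L f0) n k - fourier_coeff L (density (f t)) k) \<le> B"
proof -
  define dt where "dt = T / real N"
  define t where "t = real n * dt"
  have dt: "0 < dt" using T_pos N by (simp add: dt_def)
  have tT: "real n * dt \<le> T"
    unfolding dt_def by (rule grid_time_le[OF T_pos N n])
  have t: "t \<in> {0..T}" using tT dt by (simp add: t_def)
  let ?f = "scheme_f M \<epsilon> dt (fourier_x L f0) n k" and ?g = "fourier_x L (f t) k"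
  have f: "integrable lborel ?f"
    by (rule integrable_scheme_f[where g="fourier_x L f0", OF f0_int])
  have "(LINT v|lborel. cmod (?f v - ?g v))
      \<le> (2 + 4 * T / \<epsilon>\<^sup>2) * tail_mass W + 4 * T * core_mass W / \<epsilon> ^ 4 * dt"
    unfolding t_def by (rule global_error[OF W J_int dt _ tT]) (simp add: f_initial)
  with B have err: "(LINT v|lborel. cmod (?f v - ?g v)) \<le> B" unfolding dt_def by linarith
  then have "L1_dist ?f ?g \<le> ennreal B"
    unfolding L1_dist_eq[OF f g_int[OF t]] by (rule ennreal_leI)
  moreover have "cmod (scheme_rho M \<epsilon> dt (fourier_x L f0) n k - fourier_coeff L (density (f t)) k) \<le> B"
  proof -
    have diff: "scheme_rho M \<epsilon> dt (fourier_x L f0) n k - fourier_coeff L (density (f t)) k = (LINT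
        v|lborel. ?f v - ?g v)"
      unfolding scheme_rho_eq_integral[where g="fourier_x L f0", OF f0_int eps dt]
        fourier_x_integrable(2)[OF f_regular(2)[OF t], symmetric]
      by (rule Bochner_Integration.integral_diff[OF f g_int[OF t], symmetric])
    show ?thesis
      unfolding diff by (rule order_trans[OF integral_norm_bound err])
  qed
  ultimately show ?thesis unfolding Let_def t_def dt_def by (rule conjI)
qed

lemma core_integrable_of_second_moment:
  assumes M2: "integrable lborel (\<lambda>v. (k \<bullet> v)\<^sup>2 * M v)" and f02: "finite_second_moment L f0"
  shows "integrable lborel (\<lambda>v. indicat_real UNIV v * (K v)\<^sup>2 * (cmod (fourier_x L f0 k v) + C * M v))"
proof -
  have f0_2: "integrable lborel (\<lambda>v. (k \<bullet> v)\<^sup>2 * cmod (fourier_x L f0 k v))"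
  proof (rule Bochner_Integration.integrable_bound)
    show "integrable lborel (\<lambda>v. (norm k)\<^sup>2 * ((norm v)\<^sup>2 * cmod (fourier_x L f0 k v)))"
      by (intro integrable_mult_right fourier_x_second_moment[OF f02])
    have [measurable]: "fourier_x L f0 k \<in> borel_measurable borel"
      using borel_measurable_integrable[OF f0_int] by simp
    show "(\<lambda>v. (k \<bullet> v)\<^sup>2 * cmod (fourier_x L f0 k v)) \<in> borel_measurable lborel" by simp
    have "(k \<bullet> v)\<^sup>2 \<le> (norm k)\<^sup>2 * (norm v)\<^sup>2" for v
      using power_mono[OF Cauchy_Schwarz_ineq2[of k v], of 2] by (simp add: power_mult_distrib)
    then have "(k \<bullet> v)\<^sup>2 * cmod (fourier_x L f0 k v) \<le> (norm k)\<^sup>2 * (norm v)\<^sup>2 * cmod (fourier_x L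
        f0 k v)" for v
      by (intro mult_right_mono) auto
    then show "AE v in lborel. norm ((k \<bullet> v)\<^sup>2 * cmod (fourier_x L f0 k v))
        \<le> norm ((norm k)\<^sup>2 * ((norm v)\<^sup>2 * cmod (fourier_x L f0 k v)))"
      by (auto simp: abs_mult mult.assoc)
  qed
  have "integrable lborel (\<lambda>v. (cmod (fourier_x L f0 k v) + C * M v)
      + \<epsilon>\<^sup>2 * ((k \<bullet> v)\<^sup>2 * cmod (fourier_x L f0 k v) + C * ((k \<bullet> v)\<^sup>2 * M v)))"
    by (intro Bochner_Integration.integrable_add[OF G_int] integrable_mult_right
        Bochner_Integration.integrable_add f0_2 M2)
  then show ?thesis by (simp add: K_sq algebra_simps)
qed

lemma local_error_order_one:
  assumes J: "integrable lborel (\<lambda>v. indicat_real UNIV v * (K v)\<^sup>2 * (cmod (fourier_x L f0 k v) + C * M v))"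
    and t: "0 \<le> t" "0 < dt" "t + dt \<le> T"
  shows "L1_dist (scheme_f M \<epsilon> dt (fourier_x L (f t)) 1 k) (fourier_x L (f (t + dt)) k)
    \<le> ennreal (4 * core_mass UNIV / \<epsilon> ^ 4 * dt\<^sup>2)"
proof -
  let ?g = "\<lambda>t. fourier_x L (f t) k"
  have t': "t + dt \<in> {0..T}" "t \<in> {0..T}" using t by auto
  have st: "scheme_f M \<epsilon> dt (fourier_x L (f t)) 1 k = euler_step \<epsilon> dt k (?g t)"
    using scheme_f_Suc[of \<epsilon> dt "fourier_x L (f t)" 0 k] by simp
  have "L1_dist (scheme_f M \<epsilon> dt (fourier_x L (f t)) 1 k) (?g (t + dt))
      = ennreal (LINT v|lborel. cmod (euler_step \<epsilon> dt k (?g t) v - ?g (t + dt) v))"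
    unfolding st by (intro L1_dist_eq integrable_euler_step g_int t')
  also have "\<dots> \<le> ennreal (4 * core_mass UNIV / \<epsilon> ^ 4 * dt\<^sup>2)"
    by (intro ennreal_leI local_error J t) auto
  finally show ?thesis .
qed

lemma core_mass_nonneg: "0 \<le> core_mass W"
  unfolding core_mass_def using M_nonneg C_nonneg by (intro integral_nonneg_AE) auto

text \<open>On a slab \<open>\<bar>k \<bullet> v\<bar> \<le> m\<close> the symbol is bounded, so integrability of the envelope suffices. Only the
  component of \<open>v\<close> along \<open>k\<close> has to be truncated.\<close>

lemma truncated_core_integrable:
  "integrable lborel (\<lambda>v. indicat_real {v. \<bar>k \<bullet> v\<bar> \<le> m} v * (K v)\<^sup>2 * (cmod (fourier_x L f0 k v) + C
      * M v))"
proof (rule Bochner_Integration.integrable_bound)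
  show "integrable lborel (\<lambda>v. (1 + \<epsilon>\<^sup>2 * m\<^sup>2) * (cmod (fourier_x L f0 k v) + C * M v))"
    by (intro integrable_mult_right G_int)
  have "{v. \<bar>k \<bullet> v\<bar> \<le> m} \<in> sets borel" by measurable
  then show "(\<lambda>v. indicat_real {v. \<bar>k \<bullet> v\<bar> \<le> m} v * (K v)\<^sup>2 * (cmod (fourier_x L f0 k v) + C * M v))
      \<in> borel_measurable lborel"
    using G_measurable by (intro borel_measurable_times) auto
  have "indicat_real {v. \<bar>k \<bullet> v\<bar> \<le> m} v * (K v)\<^sup>2 \<le> 1 + \<epsilon>\<^sup>2 * m\<^sup>2" for v
  proof (cases "\<bar>k \<bullet> v\<bar> \<le> m")
    case True
    from power_mono[OF this, of 2] have "(k \<bullet> v)\<^sup>2 \<le> m\<^sup>2" by simp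
    then have "\<epsilon>\<^sup>2 * (k \<bullet> v)\<^sup>2 \<le> \<epsilon>\<^sup>2 * m\<^sup>2" by (rule mult_left_mono) simp
    with True show ?thesis by (simp add: K_sq)
  qed auto
  then have "indicat_real {v. \<bar>k \<bullet> v\<bar> \<le> m} v * (K v)\<^sup>2 * (cmod (fourier_x L f0 k v) + C * M v)
      \<le> (1 + \<epsilon>\<^sup>2 * m\<^sup>2) * (cmod (fourier_x L f0 k v) + C * M v)" for v
    using C_nonneg M_nonneg[of v] by (intro mult_right_mono) auto
  moreover have "0 \<le> cmod (fourier_x L f0 k v) + C * M v" for v
    using C_nonneg M_nonneg[of v] by simp
  ultimately show "AE v in lborel. norm (indicat_real {v. \<bar>k \<bullet> v\<bar> \<le> m} v * (K v)\<^sup>2 * (cmod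
      (fourier_x L f0 k v) + C * M v))
      \<le> norm ((1 + \<epsilon>\<^sup>2 * m\<^sup>2) * (cmod (fourier_x L f0 k v) + C * M v))"
    by (intro always_eventually allI) (simp add: abs_mult)
qed

lemma tail_mass_tendsto_0: "(\<lambda>m. tail_mass {v. \<bar>k \<bullet> v\<bar> \<le> real m}) \<longlonglongrightarrow> 0"
proof -
  let ?G = "\<lambda>v. cmod (fourier_x L f0 k v) + C * M v"
  have "(\<lambda>m. LINT v|lborel. indicat_real (- {v. \<bar>k \<bullet> v\<bar> \<le> real m}) v * ?G v) \<longlonglongrightarrow> (LINT v|(lborel ::
      (real ^ 'd) measure). 0)"
  proof (rule integral_dominated_convergence[where w="\<lambda>v. norm (?G v)"])
    show "integrable lborel (\<lambda>v. norm (?G v))" using G_int by (rule integrable_norm)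
    have "- {v. \<bar>k \<bullet> v\<bar> \<le> m} \<in> sets borel" for m by measurable
    then show "(\<lambda>v. indicat_real (- {v. \<bar>k \<bullet> v\<bar> \<le> real m}) v * ?G v) \<in> borel_measurable lborel" for m
      using G_measurable by (intro borel_measurable_times) auto
    show "AE v in lborel. (\<lambda>m. indicat_real (- {v. \<bar>k \<bullet> v\<bar> \<le> real m}) v * ?G v) \<longlonglongrightarrow> 0"
    proof (intro always_eventually allI)
      fix v
      obtain m0 where m0: "\<bar>k \<bullet> v\<bar> \<le> real m0" using real_arch_simple by blast
      have "eventually (\<lambda>m. indicat_real (- {v. \<bar>k \<bullet> v\<bar> \<le> real m}) v * ?G v = 0) sequentially"
        using eventually_ge_at_top[of m0] by eventually_elim (use m0 in auto)
      then show "(\<lambda>m. indicat_real (- {v. \<bar>k \<bullet> v\<bar> \<le> real m}) v * ?G v) \<longlonglongrightarrow> 0"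
        by (rule tendsto_eventually)
    qed
    show "AE v in lborel. norm (indicat_real (- {v. \<bar>k \<bullet> v\<bar> \<le> real m}) v * ?G v) \<le> norm (?G v)" for m
      by (intro always_eventually allI) (auto simp: indicator_def)
  qed simp
  then show ?thesis by (simp add: tail_mass_def)
qed

end

lemma kinetic_mode_exists:
  assumes eq: "equilibrium M" and L: "\<And>i. 0 < L $ i" and M: "\<And>v. 0 < M v" and \<epsilon>: "0 < \<epsilon>" and T: "0 < T"
    and sol: "kinetic_solution L M T \<epsilon> f0 f" and k: "k \<in> dual_lattice L"
  shows "\<exists>C. kinetic_mode L M T \<epsilon> f0 f k C"
proof -
  interpret equilibrium M by (rule eq)
  interpret kinetic_flow L M T \<epsilon> f0 f by unfold_locales (fact L M \<epsilon> sol)+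
  obtain C where C: "0 \<le> C" and env: "\<forall>t\<in>{0..T}. \<forall>v.
    cmod (fourier_x L (f t) k v) \<le> cmod (fourier_x L f0 k v) + C * M v \<and>
    cmod (rho_hat k t) * M v \<le> cmod (fourier_x L f0 k v) + C * M v"
    using mode_envelope[OF k] by (elim exE conjE) (rule that)
  have rho: "(LINT w|lborel. fourier_x L (f t) k w) = rho_hat k t" if "t \<in> {0..T}" for t
    by (rule fourier_x_integrable(2)[OF f_regular(2)[OF that]])
  have "kinetic_mode L M T \<epsilon> f0 f k C"
  proof unfold_locales
    show "integrable lborel (fourier_x L (f t) k)" if "t \<in> {0..T}" for t
      by (rule fourier_x_integrable(1)[OF f_regular(2)[OF that]])
    have "0 \<in> {0..T}" using T by simp
    from fourier_x_integrable(1)[OF f_regular(2)[OF this], of k]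
    have "integrable lborel (fourier_x L f0 k)" unfolding f_initial .
    then show "integrable lborel (\<lambda>v. cmod (fourier_x L f0 k v) + C * M v)"
      using M_int by simp
    fix t v assume t: "t \<in> {0..T}"
    show "((\<lambda>s. fourier_x L (f s) k v) has_vector_derivative
        ((LINT w|lborel. fourier_x L (f t) k w) * of_real (M v)
          - (1 + \<i> * of_real (\<epsilon> * (k \<bullet> v))) * fourier_x L (f t) k v) / of_real (\<epsilon>\<^sup>2)) (at t within {0..T})"
      unfolding rho[OF t] by (rule fourier_mode_ode[OF k t])
    show "cmod (fourier_x L (f t) k v) \<le> cmod (fourier_x L f0 k v) + C * M v"
      by (rule env[THEN bspec, THEN spec, THEN conjunct1, OF t])
    show "cmod (LINT w|lborel. fourier_x L (f t) k w) * M v \<le> cmod (fourier_x L f0 k v) + C * M v"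
      unfolding rho[OF t] by (rule env[THEN bspec, THEN spec, THEN conjunct2, OF t])
  qed (fact eps C T)+
  then show ?thesis by (rule exI)
qed

lemma accurate_of_order_one:
  assumes eq: "equilibrium M" and L: "\<And>i. 0 < L $ i" and M: "\<And>v. 0 < M v" and \<epsilon>: "0 < \<epsilon>" and T: "0 < T"
    and M2: "\<And>k. integrable lborel (\<lambda>v. (k \<bullet> v)\<^sup>2 * M v)"
    and f02: "finite_second_moment L f0"
  shows "accurate_of_order 1 L M T \<epsilon> (scheme_f M) (scheme_rho M) f0"
  unfolding accurate_of_order_def
proof (intro allI impI ballI)
  fix f k assume sol: "kinetic_solution L M T \<epsilon> f0 f" and k: "k \<in> dual_lattice L"
  obtain C where mode: "kinetic_mode L M T \<epsilon> f0 f k C"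
    using kinetic_mode_exists[OF eq L M \<epsilon> T sol k] by (rule exE)
  interpret kinetic_mode L M T \<epsilon> f0 f k C by (rule mode)
  note J = core_integrable_of_second_moment[OF M2 f02]
  let ?c = "4 * core_mass UNIV / \<epsilon> ^ 4"
  have c: "0 \<le> ?c" using core_mass_nonneg by simp
  have tail: "tail_mass UNIV = 0" by (simp add: tail_mass_def)
  show "\<exists>D.
      (\<forall>t dt. 0 \<le> t \<and> 0 < dt \<and> t + dt \<le> T \<longrightarrow>
         L1_dist (scheme_f M \<epsilon> dt (fourier_x L (f t)) 1 k) (fourier_x L (f (t + dt)) k)
           \<le> ennreal (D * dt ^ (1 + 1))) \<and>
      (\<forall>N\<ge>1. \<forall>n\<le>N. let dt = T / real N; t = real n * dt in
         L1_dist (scheme_f M \<epsilon> dt (fourier_x L f0) n k) (fourier_x L (f t) k) \<le> ennreal (D * dt ^ 1) \<and>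
         cmod (scheme_rho M \<epsilon> dt (fourier_x L f0) n k - fourier_coeff L (density (f t)) k) \<le> D * dt ^ 1)"
  proof (intro exI[of _ "(1 + T) * ?c"] conjI allI impI)
    fix t dt assume t: "0 \<le> t \<and> 0 < dt \<and> t + dt \<le> T"
    have "1 * ?c * dt\<^sup>2 \<le> (1 + T) * ?c * dt\<^sup>2" using c T by (intro mult_right_mono) auto
    then have "?c * dt\<^sup>2 \<le> (1 + T) * ?c * dt ^ (1 + 1)" unfolding one_add_one mult_1 .
    from local_error_order_one[OF J, of t dt] t ennreal_leI[OF this]
    show "L1_dist (scheme_f M \<epsilon> dt (fourier_x L (f t)) 1 k) (fourier_x L (f (t + dt)) k)
        \<le> ennreal ((1 + T) * ?c * dt ^ (1 + 1))"
      by (meson order_trans)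
  next
    fix N n :: nat assume N: "1 \<le> N" and n: "n \<le> N"
    have "T * ?c * (T / real N) \<le> (1 + T) * ?c * (T / real N)"
      using c T by (intro mult_right_mono) auto
    then have "(2 + 4 * T / \<epsilon>\<^sup>2) * tail_mass UNIV + 4 * T * core_mass UNIV / \<epsilon> ^ 4 * (T / real N)
        \<le> (1 + T) * ?c * (T / real N)"
      unfolding tail by simp
    from discrete_errors[OF _ J N n this]
    show "let dt = T / real N; t = real n * dt in
         L1_dist (scheme_f M \<epsilon> dt (fourier_x L f0) n k) (fourier_x L (f t) k)
           \<le> ennreal ((1 + T) * ?c * dt ^ 1) \<and>
         cmod (scheme_rho M \<epsilon> dt (fourier_x L f0) n k - fourier_coeff L (density (f t)) k)
           \<le> (1 + T) * ?c * dt ^ 1"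
      unfolding Let_def power_one_right by simp
  qed
qed

text \<open>Convergence without moments is a two-parameter argument: the truncation \<open>m\<close> is chosen first, to
  make the tail small independently of \<open>dt\<close>, and then the number of steps, which may depend on \<open>m\<close>.\<close>

lemma scheme_consistent_kinetic:
  assumes eq: "equilibrium M" and L: "\<And>i. 0 < L $ i" and M: "\<And>v. 0 < M v" and \<epsilon>: "0 < \<epsilon>" and T: "0 < T"
  shows "consistent_kinetic L M T \<epsilon> (scheme_f M) (scheme_rho M) f0"
  unfolding consistent_kinetic_def
proof (intro allI impI ballI conjI)
  fix f k assume sol: "kinetic_solution L M T \<epsilon> f0 f" and k: "k \<in> dual_lattice L"
  obtain C where mode: "kinetic_mode L M T \<epsilon> f0 f k C"
    using kinetic_mode_exists[OF eq L M \<epsilon> T sol k] by (rule exE)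
  interpret kinetic_mode L M T \<epsilon> f0 f k C by (rule mode)
  {
    fix t v assume t: "0 \<le> t \<and> t < T"
    have "scheme_f M \<epsilon> dt (fourier_x L (f t)) 1 k v = euler_step \<epsilon> dt k (fourier_x L (f t) k) v" for dt
      using scheme_f_Suc[of \<epsilon> dt "fourier_x L (f t)" 0 k] by simp
    with truncation_error[of t v] t
    show "((\<lambda>dt. (fourier_x L (f (t + dt)) k v - scheme_f M \<epsilon> dt (fourier_x L (f t)) 1 k v) / of_real dt)
        \<longlongrightarrow> 0) (at_right 0)"
      by (simp only:)
  }
  fix \<eta> :: real assume \<eta>: "0 < \<eta>"
  let ?W = "\<lambda>m::nat. {v. \<bar>k \<bullet> v\<bar> \<le> real m}"
  have "(\<lambda>m. (2 + 4 * T / \<epsilon>\<^sup>2) * tail_mass (?W m)) \<longlonglongrightarrow> (2 + 4 * T / \<epsilon>\<^sup>2) * 0"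
    by (intro tendsto_intros tail_mass_tendsto_0)
  then have "eventually (\<lambda>m. (2 + 4 * T / \<epsilon>\<^sup>2) * tail_mass (?W m) < \<eta> / 2) sequentially"
    using \<eta> by (intro order_tendstoD(2)) auto
  then obtain m where m: "(2 + 4 * T / \<epsilon>\<^sup>2) * tail_mass (?W m) < \<eta> / 2"
    unfolding eventually_sequentially by blast
  have "(\<lambda>N. 4 * T * core_mass (?W m) / \<epsilon> ^ 4 * (T / real N)) \<longlonglongrightarrow> 4 * T * core_mass (?W m) / \<epsilon> ^ 4 * 0"
    by (intro tendsto_mult tendsto_const lim_const_over_n)
  then have "eventually (\<lambda>N. 4 * T * core_mass (?W m) / \<epsilon> ^ 4 * (T / real N) < \<eta> / 2) sequentially"
    using \<eta> by (intro order_tendstoD(2)) auto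
  then obtain N0 where N0: "\<And>N. N0 \<le> N \<Longrightarrow> 4 * T * core_mass (?W m) / \<epsilon> ^ 4 * (T / real N) < \<eta> / 2"
    unfolding eventually_sequentially by blast
  show "\<exists>N0\<ge>1. \<forall>N\<ge>N0. \<forall>n\<le>N. let dt = T / real N; t = real n * dt in
         L1_dist (scheme_f M \<epsilon> dt (fourier_x L f0) n k) (fourier_x L (f t) k) \<le> ennreal \<eta> \<and>
         cmod (scheme_rho M \<epsilon> dt (fourier_x L f0) n k - fourier_coeff L (density (f t)) k) \<le> \<eta>"
  proof (intro exI[of _ "max 1 N0"] conjI allI impI)
    fix N n assume N: "max 1 N0 \<le> N" and n: "n \<le> N"
    have W: "?W m \<in> sets borel" by measurable
    have "(2 + 4 * T / \<epsilon>\<^sup>2) * tail_mass (?W m) + 4 * T * core_mass (?W m) / \<epsilon> ^ 4 * (T / real N) \<le> \<eta>"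
      using m N0[of N] N by auto
    then show "let dt = T / real N; t = real n * dt in
         L1_dist (scheme_f M \<epsilon> dt (fourier_x L f0) n k) (fourier_x L (f t) k) \<le> ennreal \<eta> \<and>
         cmod (scheme_rho M \<epsilon> dt (fourier_x L f0) n k - fourier_coeff L (density (f t)) k) \<le> \<eta>"
      using N by (intro discrete_errors[OF W truncated_core_integrable _ n]) auto
  qed simp
qed

text \<open>The limit scheme is implicit Euler for a scalar linear equation, whose powers
  \<open>(1 + D dt) ^ -n\<close> approximate the exponential uniformly on \<open>[0, T]\<close>.\<close>

lemma scheme_degenerates_to_diffusion:
  assumes eq: "equilibrium M" and T: "0 < T"
    and M1: "\<And>k. integrable lborel (\<lambda>v. (k \<bullet> v) * M v)" "\<And>k. (LINT v|lborel. (k \<bullet> v) * M v) = 0"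
    and M2: "\<And>k. integrable lborel (\<lambda>v. (k \<bullet> v)\<^sup>2 * M v)"
    and f0: "initial_datum L f0"
  shows "degenerates_to_diffusion L M T (scheme_rho M) f0"
  unfolding degenerates_to_diffusion_def
proof
  interpret equilibrium M by (rule eq)
  fix k
  let ?D = "diffusion_coeff M k" and ?rho0 = "fourier_coeff L (density f0) k"
  have D: "0 \<le> ?D" by (rule diffusion_coeff_nonneg)
  have f0': "set_integrable lborel (cell L \<times> UNIV) (\<lambda>(x, v). f0 x v)"
    using f0 by (simp add: initial_datum_def)
  let ?lim = "\<lambda>N n. ?rho0 / complex_of_real (1 + T / real N * ?D) ^ n"
  show "\<exists>r :: nat \<Rightarrow> nat \<Rightarrow> complex.
      (\<forall>N\<ge>1. \<forall>n\<le>N. ((\<lambda>\<epsilon>. scheme_rho M \<epsilon> (T / real N) (fourier_x L f0) n k) \<longlongrightarrow> r N n) (at_right 0)) \<and>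
      (\<forall>u. diffusion_solution M T k ?rho0 u \<longrightarrow>
         (\<forall>\<eta>>0. \<exists>N0\<ge>1. \<forall>N\<ge>N0. \<forall>n\<le>N. cmod (r N n - u (real n * (T / real N))) \<le> \<eta>))"
  proof (intro exI[of _ ?lim] conjI allI impI)
    fix N n :: nat assume "1 \<le> N"
    then have "0 < T / real N" using T by simp
    from scheme_diffusive_limit[where g="fourier_x L f0", OF this M1 M2 fourier_x_integrable(1)[OF
        f0'], THEN conjunct2]
    show "((\<lambda>\<epsilon>. scheme_rho M \<epsilon> (T / real N) (fourier_x L f0) n k) \<longlongrightarrow> ?lim N n) (at_right 0)"
      unfolding fourier_x_integrable(2)[OF f0'] .
  next
    fix u and \<eta> :: real assume u: "diffusion_solution M T k ?rho0 u" and \<eta>: "0 < \<eta>"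
    let ?c = "cmod ?rho0 * (T * ?D\<^sup>2)"
    have "(\<lambda>N. ?c * (T / real N)) \<longlonglongrightarrow> ?c * 0"
      by (intro tendsto_mult tendsto_const lim_const_over_n)
    then have "eventually (\<lambda>N. ?c * (T / real N) < \<eta>) sequentially"
      using \<eta> by (intro order_tendstoD(2)) auto
    then obtain N0 where N0: "\<And>N. N0 \<le> N \<Longrightarrow> ?c * (T / real N) < \<eta>"
      unfolding eventually_sequentially by blast
    show "\<exists>N0\<ge>1. \<forall>N\<ge>N0. \<forall>n\<le>N. cmod (?lim N n - u (real n * (T / real N))) \<le> \<eta>"
    proof (intro exI[of _ "max 1 N0"] conjI allI impI)
      fix N n assume N: "max 1 N0 \<le> N" and n: "n \<le> N"
      let ?dt = "T / real N"
      have dt: "0 < ?dt" using T N by simp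
      have nT: "real n * ?dt \<le> T"
        using N n by (intro grid_time_le[OF T]) auto
      have "u (real n * ?dt) = ?rho0 * of_real (exp (- ?D * (real n * ?dt)))"
        using nT mult_nonneg_nonneg[OF of_nat_0_le_iff less_imp_le[OF dt]]
        by (intro diffusion_solution_eq[OF u]) (simp only: atLeastAtMost_iff)
      then have "?lim N n - u (real n * ?dt)
          = ?rho0 * of_real (1 / (1 + ?dt * ?D) ^ n - exp (- (real n * (?dt * ?D))))"
        by (simp add: right_diff_distrib ac_simps)
      then have "cmod (?lim N n - u (real n * ?dt))
          = cmod ?rho0 * \<bar>1 / (1 + ?dt * ?D) ^ n - exp (- (real n * (?dt * ?D)))\<bar>"
        by (simp only: norm_mult norm_of_real)
      also have "\<dots> \<le> cmod ?rho0 * (real n * (?dt * ?D)\<^sup>2)"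
        by (intro mult_left_mono implicit_euler_exp_error mult_nonneg_nonneg less_imp_le[OF dt] D
            norm_ge_zero)
      also have "\<dots> = cmod ?rho0 * (real n * ?dt * ?D\<^sup>2) * ?dt" by (simp only: power2_eq_square ac_simps)
      also have "\<dots> \<le> ?c * ?dt"
        using nT dt by (intro mult_right_mono mult_left_mono) auto
      also have "\<dots> \<le> \<eta>" using N0[of N] N by auto
      finally show "cmod (?lim N n - u (real n * ?dt)) \<le> \<eta>" .
    qed simp
  qed
qed

lemma diffusive_limit_scheme:
  assumes eq: "equilibrium M" and dt: "0 < dt"
    and M1: "\<And>k. integrable lborel (\<lambda>v. (k \<bullet> v) * M v)" "\<And>k. (LINT v|lborel. (k \<bullet> v) * M v) = 0"
    and M2: "\<And>k. integrable lborel (\<lambda>v. (k \<bullet> v)\<^sup>2 * M v)"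
    and f0: "initial_datum L f0"
  shows "\<exists>r :: nat \<Rightarrow> complex.
    (\<forall>n. ((\<lambda>\<epsilon>. scheme_rho M \<epsilon> dt (fourier_x L f0) n k) \<longlongrightarrow> r n) (at_right 0)) \<and>
    (\<forall>n. (r (n + 1) - r n) / of_real dt = - of_real (diffusion_coeff M k) * r (n + 1))"
proof -
  interpret equilibrium M by (rule eq)
  let ?D = "diffusion_coeff M k"
  define r where "r n = (LINT v|lborel. fourier_x L f0 k v) / complex_of_real (1 + dt * ?D) ^ n" for n
  have f0': "set_integrable lborel (cell L \<times> UNIV) (\<lambda>(x, v). f0 x v)"
    using f0 by (simp add: initial_datum_def)
  have "((\<lambda>\<epsilon>. scheme_rho M \<epsilon> dt (fourier_x L f0) n k) \<longlongrightarrow> r n) (at_right 0)" for n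
    unfolding r_def
    by (rule scheme_diffusive_limit[where g="fourier_x L f0", OF dt M1 M2 fourier_x_integrable(1)[OF
        f0'], THEN conjunct2])
  moreover have "(r (n + 1) - r n) / of_real dt = - of_real ?D * r (n + 1)" for n
  proof -
    have "0 < 1 + dt * ?D" using dt diffusion_coeff_nonneg by (intro add_pos_nonneg) auto
    then have "complex_of_real (1 + dt * ?D) \<noteq> 0" by (metis less_irrefl of_real_eq_0_iff)
    then have "r n = of_real (1 + dt * ?D) * r (n + 1)" by (simp add: r_def del: of_real_add of_real_mult)
    then have "r (n + 1) - r n = of_real dt * (- of_real ?D * r (n + 1))" by (simp add: algebra_simps)
    then show ?thesis using dt by simp
  qed
  ultimately show ?thesis by blast
qed

theorem proposition3p1:
  fixes M :: "real ^ 'd \<Rightarrow> real" and L :: "real ^ 'd" and T :: real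
  assumes "CARD('d) \<in> {1, 2, 3}"
    and "\<And>i. L $ i > 0" and "T > 0"
    and "\<And>v. M (- v) = M v" and "\<And>v. M v > 0"
    and "integrable lborel M" and "(LINT v|lborel. M v) = 1"
    and "integrable lborel (\<lambda>v. M v *\<^sub>R v)" and "(LINT v|lborel. M v *\<^sub>R v) = 0"
    and "\<And>i j. integrable lborel (\<lambda>v. v $ i * v $ j * M v)"
  shows
    "(\<forall>\<epsilon>>0. \<forall>f0. initial_datum L f0 \<and> finite_second_moment L f0 \<longrightarrow>
        accurate_of_order 1 L M T \<epsilon> (scheme_f M) (scheme_rho M) f0) \<and>
     (\<forall>\<epsilon>>0. \<forall>f0. initial_datum L f0 \<longrightarrow> (\<forall>N\<ge>1. \<forall>n\<in>{1..N}.
        scheme_rho M \<epsilon> (T / real N) (fourier_x L f0) n 0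
          = scheme_rho M \<epsilon> (T / real N) (fourier_x L f0) 0 0)) \<and>
     asymptotic_preserving L M T (scheme_f M) (scheme_rho M) \<and>
     (\<forall>f0. initial_datum L f0 \<longrightarrow> (\<forall>N\<ge>1. \<forall>k\<in>dual_lattice L. \<exists>r :: nat \<Rightarrow> complex.
        (\<forall>n\<le>N. ((\<lambda>\<epsilon>. scheme_rho M \<epsilon> (T / real N) (fourier_x L f0) n k) \<longlongrightarrow> r n) (at_right 0)) \<and>
        (\<forall>n<N. (r (n + 1) - r n) / of_real (T / real N)
           = - of_real (diffusion_coeff M k) * r (n + 1))))"
proof -
  have eq: "equilibrium M" using assms(5-7) by unfold_locales (auto simp: less_imp_le)
  interpret equilibrium M by (rule eq)
  have M1: "integrable lborel (\<lambda>v. (k \<bullet> v) * M v)" "(LINT v|lborel. (k \<bullet> v) * M v) = 0" for k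
  proof -
    have eq: "(k \<bullet> v) * M v = k \<bullet> (M v *\<^sub>R v)" for v by simp
    show "integrable lborel (\<lambda>v. (k \<bullet> v) * M v)"
      unfolding eq using assms(8) by (rule integrable_inner_right)
    show "(LINT v|lborel. (k \<bullet> v) * M v) = 0"
      unfolding eq integral_inner_right[OF assms(8)] assms(9) by simp
  qed
  have M2: "integrable lborel (\<lambda>v. (k \<bullet> v)\<^sup>2 * M v)" for k
  proof -
    have "(k \<bullet> v)\<^sup>2 * M v = (\<Sum>i\<in>UNIV. \<Sum>j\<in>UNIV. (k $ i * k $ j) * (v $ i * v $ j * M v))" for v
      unfolding inner_vec_def inner_real_def power2_eq_square
      unfolding sum_product
      unfolding sum_distrib_right
      by (intro sum.cong refl) (simp add: ac_simps)
    then show ?thesis using assms(10) by simp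
  qed
  have "accurate_of_order 1 L M T \<epsilon> (scheme_f M) (scheme_rho M) f0"
    if "0 < \<epsilon>" "finite_second_moment L f0" for \<epsilon> f0
    by (rule accurate_of_order_one[OF eq assms(2) assms(5) that(1) assms(3) M2 that(2)])
  moreover have "scheme_rho M \<epsilon> (T / real N) (fourier_x L f0) n 0
          = scheme_rho M \<epsilon> (T / real N) (fourier_x L f0) 0 0"
    if "0 < \<epsilon>" "initial_datum L f0" "1 \<le> N" for \<epsilon> f0 N n
  proof (rule mass_conservation)
    show "integrable lborel (fourier_x L f0 0)"
      using that(2) by (intro fourier_x_integrable) (simp add: initial_datum_def)
  qed (use that assms(3) in auto)
  moreover have "asymptotic_preserving L M T (scheme_f M) (scheme_rho M)"
    unfolding asymptotic_preserving_def
    by (intro allI impI conjI scheme_consistent_kinetic[OF eq assms(2) assms(5) _ assms(3)]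
        scheme_degenerates_to_diffusion[OF eq assms(3) M1 M2])
  moreover have "\<exists>r :: nat \<Rightarrow> complex.
        (\<forall>n\<le>N. ((\<lambda>\<epsilon>. scheme_rho M \<epsilon> (T / real N) (fourier_x L f0) n k) \<longlongrightarrow> r n) (at_right 0)) \<and>
        (\<forall>n<N. (r (n + 1) - r n) / of_real (T / real N)
           = - of_real (diffusion_coeff M k) * r (n + 1))"
    if "initial_datum L f0" "1 \<le> N" for f0 N k
  proof -
    have "0 < T / real N" using that(2) assms(3) by simp
    from diffusive_limit_scheme[OF eq this M1 M2 that(1), of k] show ?thesis by blast
  qed
  ultimately show ?thesis by blast
qed

end
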